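(* Let $\mathcal{H}=L^2(\mathbb{R}^d)$ (real-valued functions), let $\kappa\in\mathbb{R}$ and let $F:\mathbb{R}\to[0,\infty)$ be a non-negative convex $C^1$ function with $F(0)=0$. Let $$\mathcal{E}(\rho)=\frac12\int_{\mathbb{R}^d}|\nabla\rho(x)|^2+\kappa|\rho(x)|^2\,dx+\int_{\mathbb{R}^d}F(\rho(x))\,dx,$$ with $\mathcal{E}(\rho)=+\infty$ if $\rho\notin H^1(\mathbb{R}^d)$ or $F(\rho)\notin L^1(\mathbb{R}^d)$. Put $E=\mathcal{H}$ and $d(\rho,\pi)=\|\rho-\pi\|_{L^2}$. Then for every $\lambda>0$, all bounded and uniformly continuous $h^\dagger,h^\ddagger:E\to\mathbb{R}$, every viscosity subsolution $u:E\to\mathbb{R}$ to $f-\lambda H_\dagger f=h^\dagger$ and every viscosity supersolution $v:E\to\mathbb{R}$ to $f-\lambda H_\ddagger f=h^\ddagger$, $$\sup_{\pi\in E}\big(u(\pi)-v(\pi)\big)\le\sup_{\pi\in E}\big(h^\dagger(\pi)-h^\ddagger(\pi)\big).$$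
   Context: Domain: $\mathcal{D}(\mathcal{E})=\{\pi\in E:\mathcal{E}(\pi)<+\infty\}$. EVI gradient flow: a solution of $EVI_\kappa$ is a continuous curve $\gamma:[0,+\infty)\to E$ with $\gamma((0,+\infty))\subseteq\mathcal{D}(\mathcal{E})$ such that for all $\rho\in\mathcal{D}(\mathcal{E})$, $t\in[0,+\infty)$, $$\frac12\frac{d^+}{dt}d^2(\gamma(t),\rho)\le\mathcal{E}(\rho)-\mathcal{E}(\gamma(t))-\frac{\kappa}{2}d^2(\gamma(t),\rho),$$ where $\frac{d^+}{dt}$ is the upper right time derivative. An $EVI_\kappa$ gradient flow of $\mathcal{E}$ on $E$ is a family of continuous maps $S(t):E\to E$, $t\ge0$, such that for every $\pi\in E$: $S[\pi](0)=\pi$, $S[\pi](t+s)=S[S[\pi](t)](s)$ for $s,t\ge0$, and $t\mapsto S[\pi](t)$ is a solution of $EVI_\kappa$. One writes $\pi(t):=S[\pi](t)$. In the setting of the claim this flow exists and is unique (Brezis–Pazy theorem for $\kappa$-convex lower semi-continuous functionals on Hilbert spaces), and it is the one used below. Tataru distance: with $\hat\kappa=\min(0,\kappa)$, $d_T(\pi,\rho)=\inf_{t\ge0}\{t+e^{\hat\kappa t}d(\pi,\rho(t))\}$ for $\pi,\rho\in E$. Hamiltonians: $H_\dagger$ is the set of all pairs $(f^\dagger,g^\dagger)$ of functions on $E$, indexed by $a,b>0$, $c\in\mathbb{R}$, $\mu,\rho\in E$ with $\mathcal{E}(\rho)<\infty$, of the form $$f^\dagger(\pi)=\tfrac12 a\,d^2(\pi,\rho)+b\,d_T(\pi,\mu)+c,$$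 $$g^\dagger(\pi)=a[\mathcal{E}(\rho)-\mathcal{E}(\pi)]-a\tfrac{\kappa}{2}d^2(\pi,\rho)+b+\tfrac12a^2d^2(\pi,\rho)+ab\,d(\pi,\rho)+\tfrac12b^2.$$ $H_\ddagger$ is the set of all pairs $(f^\ddagger,g^\ddagger)$, indexed by $a,b>0$, $c\in\mathbb{R}$, $\pi,\gamma\in E$ with $\mathcal{E}(\gamma)<\infty$, of the form $$f^\ddagger(\mu)=-\tfrac12a\,d^2(\gamma,\mu)-b\,d_T(\mu,\pi)+c,$$ $$g^\ddagger(\mu)=a[\mathcal{E}(\mu)-\mathcal{E}(\gamma)]+a\tfrac{\kappa}{2}d^2(\gamma,\mu)-b+\tfrac12a^2d^2(\gamma,\mu)-ab\,d(\gamma,\mu)-\tfrac12b^2.$$ Viscosity solutions: $u$ is a (viscosity) subsolution of $f-\lambda H_\dagger f=h^\dagger$ if $u$ is bounded, upper semi-continuous and for all $(f,g)\in H_\dagger$ there is a sequence $(\pi_n)$ in $E$ with $\lim_n (u(\pi_n)-f(\pi_n))=\sup_\pi (u(\pi)-f(\pi))$ and $\limsup_n (u(\pi_n)-\lambda g(\pi_n)-h^\dagger(\pi_n))\le0$. $v$ is a (viscosity) supersolution of $f-\lambda H_\ddagger f=h^\ddagger$ if $v$ is bounded, lower semi-continuous and for all $(f,g)\in H_\ddagger$ there is a sequence $(\pi_n)$ in $E$ with $\lim_n (v(\pi_n)-f(\pi_n))=\inf_\pi (v(\pi)-f(\pi))$ and $\liminf_n (v(\pi_n)-\lambda g(\pi_n)-h^\ddagger(\pi_n))\ge0$.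 *)

theory Defs
  imports "HOL-Analysis.Analysis"
begin

section \<open>The Hilbert space of square-integrable real functions\<close>

text \<open>Borel representatives suffice: every Lebesgue-measurable function agrees almost everywhere
  with a Borel one.\<close>

definition square_integrable :: "('a::euclidean_space \<Rightarrow> real) \<Rightarrow> bool" where
  "square_integrable f \<longleftrightarrow> f \<in> borel_measurable lborel \<and> integrable lborel (\<lambda>x. (f x)\<^sup>2)"

definition l2_rel :: "('a::euclidean_space \<Rightarrow> real) \<Rightarrow> ('a \<Rightarrow> real) \<Rightarrow> bool" where
  "l2_rel f g \<longleftrightarrow> square_integrable f \<and> square_integrable g \<and> (AE x in lborel. f x = g x)"

lemma square_integrable_zero: "square_integrable (\<lambda>x. 0)"
  by (simp add: square_integrable_def)

lemma square_integrable_scale: "square_integrable f \<Longrightarrow> square_integrable (\<lambda>x. c * f x)"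
  by (auto simp: square_integrable_def power_mult_distrib intro: borel_measurable_times)

lemma square_integrable_mult:
  assumes "square_integrable f" "square_integrable g"
  shows "integrable lborel (\<lambda>x. f x * g x)"
proof (rule Bochner_Integration.integrable_bound)
  show "integrable lborel (\<lambda>x. (f x)\<^sup>2 + (g x)\<^sup>2)"
    using assms by (simp add: square_integrable_def)
  show "(\<lambda>x. f x * g x) \<in> borel_measurable lborel"
    using assms by (simp add: square_integrable_def borel_measurable_times)
  have "\<bar>f x * g x\<bar> \<le> (f x)\<^sup>2 + (g x)\<^sup>2" for x
  proof -
    have "2 * \<bar>f x\<bar> * \<bar>g x\<bar> \<le> (f x)\<^sup>2 + (g x)\<^sup>2"
      using sum_squares_bound[of "\<bar>f x\<bar>" "\<bar>g x\<bar>"] by simp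
    moreover have "0 \<le> \<bar>f x\<bar> * \<bar>g x\<bar>" by simp
    ultimately show ?thesis unfolding abs_mult by linarith
  qed
  then show "AE x in lborel. norm (f x * g x) \<le> norm ((f x)\<^sup>2 + (g x)\<^sup>2)"
    by simp
qed

lemma square_integrable_add:
  assumes "square_integrable f" "square_integrable g"
  shows "square_integrable (\<lambda>x. f x + g x)"
proof -
  have "(\<lambda>x. (f x + g x)\<^sup>2) = (\<lambda>x. (f x)\<^sup>2 + (g x)\<^sup>2 + 2 * (f x * g x))"
    by (auto simp: power2_sum algebra_simps)
  then show ?thesis
    using assms square_integrable_mult[OF assms]
    by (auto simp: square_integrable_def intro: borel_measurable_add)
qed

lemma square_integrable_uminus: "square_integrable f \<Longrightarrow> square_integrable (\<lambda>x. - f x)"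
  using square_integrable_scale[of f "-1"] by simp

lemma square_integrable_diff:
  "square_integrable f \<Longrightarrow> square_integrable g \<Longrightarrow> square_integrable (\<lambda>x. f x - g x)"
  using square_integrable_add[of f "\<lambda>x. - g x"] square_integrable_uminus[of g] by simp

lemma part_equivp_l2_rel: "part_equivp l2_rel"
proof (rule part_equivpI)
  show "\<exists>f. l2_rel f f"
    using square_integrable_zero by (auto simp: l2_rel_def)
  show "symp l2_rel"
    by (auto simp: symp_def l2_rel_def elim: AE_mp)
  show "transp l2_rel"
    unfolding transp_def l2_rel_def by (auto elim!: AE_mp)
qed

quotient_type (overloaded) 'a l2 = "'a::euclidean_space \<Rightarrow> real" / partial: l2_rel
  by (rule part_equivp_l2_rel)

instantiation l2 :: (euclidean_space) real_inner
begin

lift_definition zero_l2 :: "'a l2" is "\<lambda>x. 0"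
  by (simp add: l2_rel_def square_integrable_zero)

lift_definition plus_l2 :: "'a l2 \<Rightarrow> 'a l2 \<Rightarrow> 'a l2" is "\<lambda>f g x. f x + g x"
  by (auto simp: l2_rel_def square_integrable_add)

lift_definition uminus_l2 :: "'a l2 \<Rightarrow> 'a l2" is "\<lambda>f x. - f x"
  by (auto simp: l2_rel_def square_integrable_uminus)

lift_definition minus_l2 :: "'a l2 \<Rightarrow> 'a l2 \<Rightarrow> 'a l2" is "\<lambda>f g x. f x - g x"
  by (auto simp: l2_rel_def square_integrable_diff)

lift_definition scaleR_l2 :: "real \<Rightarrow> 'a l2 \<Rightarrow> 'a l2" is "\<lambda>c f x. c * f x"
  by (auto simp: l2_rel_def square_integrable_scale)

lift_definition inner_l2 :: "'a l2 \<Rightarrow> 'a l2 \<Rightarrow> real" is "\<lambda>f g. LINT x|lborel. f x * g x"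
  by (rule integral_cong_AE) (auto simp: l2_rel_def square_integrable_def)

definition norm_l2 :: "'a l2 \<Rightarrow> real" where
  "norm_l2 f = sqrt (inner f f)"

definition dist_l2 :: "'a l2 \<Rightarrow> 'a l2 \<Rightarrow> real" where
  "dist_l2 f g = norm (f - g)"

definition sgn_l2 :: "'a l2 \<Rightarrow> 'a l2" where
  "sgn_l2 f = inverse (norm f) *\<^sub>R f"

definition uniformity_l2 :: "('a l2 \<times> 'a l2) filter" where
  "uniformity_l2 = (INF e\<in>{0<..}. principal {(x, y). dist x y < e})"

definition open_l2 :: "'a l2 set \<Rightarrow> bool" where
  "open_l2 U \<longleftrightarrow> (\<forall>x\<in>U. \<forall>\<^sub>F (x', y) in uniformity. x' = x \<longrightarrow> y \<in> U)"

instance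
proof
  fix f g h :: "'a l2" and c e :: real
  show "f + g + h = f + (g + h)"
    by transfer (auto simp: l2_rel_def square_integrable_add add.assoc)
  show "f + g = g + f"
    by transfer (auto simp: l2_rel_def square_integrable_add add.commute)
  show "0 + f = f"
    by transfer (auto simp: l2_rel_def)
  show "- f + f = 0"
    by transfer (auto simp: l2_rel_def square_integrable_zero)
  show "f - g = f + - g"
    by transfer (auto simp: l2_rel_def square_integrable_diff)
  show "c *\<^sub>R (f + g) = c *\<^sub>R f + c *\<^sub>R g"
    by transfer (auto simp: l2_rel_def algebra_simps intro!: square_integrable_add square_integrable_scale)
  show "(c + e) *\<^sub>R f = c *\<^sub>R f + e *\<^sub>R f"
    by transfer (auto simp: l2_rel_def algebra_simps intro!: square_integrable_add square_integrable_scale)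
  show "c *\<^sub>R e *\<^sub>R f = (c * e) *\<^sub>R f"
    by transfer (auto simp: l2_rel_def mult.assoc intro!: square_integrable_scale)
  show "1 *\<^sub>R f = f"
    by transfer (auto simp: l2_rel_def)
  show "sgn f = inverse (norm f) *\<^sub>R f" by (rule sgn_l2_def)
  show "dist f g = norm (f - g)" by (rule dist_l2_def)
  show "uniformity = (INF e\<in>{0<..}. principal {(x, y :: 'a l2). dist x y < e})"
    by (rule uniformity_l2_def)
  show "open U \<longleftrightarrow> (\<forall>x\<in>U. \<forall>\<^sub>F (x', y) in uniformity. x' = x \<longrightarrow> y \<in> U)" for U :: "'a l2 set"
    by (rule open_l2_def)
  show "inner f g = inner g f"
    by transfer (simp add: mult.commute)
  show "inner (f + g) h = inner f h + inner g h"
  proof transfer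
    fix f g h :: "'a \<Rightarrow> real"
    assume "l2_rel f f" "l2_rel g g" "l2_rel h h"
    then show "(LINT x|lborel. (f x + g x) * h x) = (LINT x|lborel. f x * h x) + (LINT x|lborel. g x * h x)"
      by (simp add: l2_rel_def distrib_right square_integrable_mult)
  qed
  show "inner (c *\<^sub>R f) g = c * inner f g"
    by transfer (simp add: mult.assoc)
  show "0 \<le> inner f f"
    by transfer simp
  show "inner f f = 0 \<longleftrightarrow> f = 0"
  proof transfer
    fix f :: "'a \<Rightarrow> real"
    assume "l2_rel f f"
    then have f: "square_integrable f" by (simp add: l2_rel_def)
    have "(LINT x|lborel. f x * f x) = 0 \<longleftrightarrow> (AE x in lborel. f x * f x = 0)"
      by (rule integral_nonneg_eq_0_iff_AE) (use square_integrable_mult[OF f f] in auto)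
    then show "(LINT x|lborel. f x * f x) = 0 \<longleftrightarrow> l2_rel f (\<lambda>x. 0)"
      using f by (simp add: l2_rel_def square_integrable_zero)
  qed
  show "norm f = sqrt (inner f f)" by (rule norm_l2_def)
qed

end

section \<open>Weak derivatives and the energy\<close>

fun continuously_differentiable :: "nat \<Rightarrow> ('a::euclidean_space \<Rightarrow> real) \<Rightarrow> bool" where
  "continuously_differentiable 0 \<phi> \<longleftrightarrow> continuous_on UNIV \<phi>"
| "continuously_differentiable (Suc k) \<phi> \<longleftrightarrow>
     (\<forall>x. \<phi> differentiable (at x)) \<and>
     (\<forall>b\<in>Basis. continuously_differentiable k (\<lambda>x. frechet_derivative \<phi> (at x) b))"

definition test_function :: "('a::euclidean_space \<Rightarrow> real) \<Rightarrow> bool" where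
  "test_function \<phi> \<longleftrightarrow>
     (\<forall>k. continuously_differentiable k \<phi>) \<and> compact (closure {x. \<phi> x \<noteq> 0})"

definition is_weak_partial :: "'a \<Rightarrow> 'a::euclidean_space l2 \<Rightarrow> 'a l2 \<Rightarrow> bool" where
  "is_weak_partial b \<rho> g \<longleftrightarrow>
     (\<forall>\<phi>. test_function \<phi> \<longrightarrow>
        (LINT x|lborel. rep_l2 \<rho> x * frechet_derivative \<phi> (at x) b) =
        - (LINT x|lborel. rep_l2 g x * \<phi> x))"

definition H1 :: "'a::euclidean_space l2 set" where
  "H1 = {\<rho>. \<forall>b\<in>Basis. \<exists>g. is_weak_partial b \<rho> g}"

definition weak_partial :: "'a \<Rightarrow> 'a::euclidean_space l2 \<Rightarrow> 'a l2" where
  "weak_partial b \<rho> = (THE g. is_weak_partial b \<rho> g)"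

definition weak_grad :: "'a::euclidean_space l2 \<Rightarrow> 'a \<Rightarrow> 'a" where
  "weak_grad \<rho> x = (\<Sum>b\<in>Basis. rep_l2 (weak_partial b \<rho>) x *\<^sub>R b)"

definition energy :: "real \<Rightarrow> (real \<Rightarrow> real) \<Rightarrow> 'a::euclidean_space l2 \<Rightarrow> ereal" where
  "energy \<kappa> F \<rho> =
     (if \<rho> \<in> H1 \<and> integrable lborel (\<lambda>x. F (rep_l2 \<rho> x))
      then ereal ((1/2) * (LINT x|lborel. (norm (weak_grad \<rho> x))\<^sup>2 + \<kappa> * \<bar>rep_l2 \<rho> x\<bar>\<^sup>2)
                  + (LINT x|lborel. F (rep_l2 \<rho> x)))
      else \<infinity>)"

section \<open>EVI gradient flows and the Tataru distance\<close>

definition energy_domain :: "('e \<Rightarrow> ereal) \<Rightarrow> 'e set" where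
  "energy_domain En = {\<pi>. En \<pi> < \<infinity>}"

definition upper_right_deriv :: "(real \<Rightarrow> real) \<Rightarrow> real \<Rightarrow> ereal" where
  "upper_right_deriv \<phi> t = Limsup (at_right 0) (\<lambda>h. ereal ((\<phi> (t + h) - \<phi> t) / h))"

text \<open>At \<open>t = 0\<close> the energy of the curve may be infinite; the inequality then says that the upper
  right derivative is \<open>-\<infinity>\<close>.\<close>

definition evi_solution :: "real \<Rightarrow> ('e::metric_space \<Rightarrow> ereal) \<Rightarrow> (real \<Rightarrow> 'e) \<Rightarrow> bool" where
  "evi_solution \<kappa> En \<gamma> \<longleftrightarrow>
     continuous_on {0..} \<gamma> \<and>
     \<gamma> ` {0<..} \<subseteq> energy_domain En \<and>
     (\<forall>\<rho>\<in>energy_domain En. \<forall>t\<ge>0.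
        ereal (1/2) * upper_right_deriv (\<lambda>s. (dist (\<gamma> s) \<rho>)\<^sup>2) t
        \<le> En \<rho> - En (\<gamma> t) - ereal (\<kappa> / 2 * (dist (\<gamma> t) \<rho>)\<^sup>2))"

definition is_evi_flow :: "real \<Rightarrow> ('e::metric_space \<Rightarrow> ereal) \<Rightarrow> (real \<Rightarrow> 'e \<Rightarrow> 'e) \<Rightarrow> bool" where
  "is_evi_flow \<kappa> En S \<longleftrightarrow>
     (\<forall>t\<ge>0. continuous_on UNIV (S t)) \<and>
     (\<forall>\<pi>. S 0 \<pi> = \<pi> \<and>
        (\<forall>s\<ge>0. \<forall>t\<ge>0. S (t + s) \<pi> = S s (S t \<pi>)) \<and>
        evi_solution \<kappa> En (\<lambda>t. S t \<pi>))"

text \<open>A flow is determined by the functional only at times \<open>t \<ge> 0\<close>, so \<open>THE\<close> would be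
  ill-defined; the values at negative times are never used.\<close>

definition evi_flow :: "real \<Rightarrow> ('e::metric_space \<Rightarrow> ereal) \<Rightarrow> real \<Rightarrow> 'e \<Rightarrow> 'e" where
  "evi_flow \<kappa> En = (SOME S. is_evi_flow \<kappa> En S)"

definition tataru_dist :: "real \<Rightarrow> (real \<Rightarrow> 'e \<Rightarrow> 'e) \<Rightarrow> 'e::metric_space \<Rightarrow> 'e \<Rightarrow> real" where
  "tataru_dist \<kappa> S \<pi> \<rho> = (INF t\<in>{0..}. t + exp (min 0 \<kappa> * t) * dist \<pi> (S t \<rho>))"

section \<open>Hamiltonians and viscosity solutions\<close>

definition H_dagger ::
  "real \<Rightarrow> ('e::metric_space \<Rightarrow> ereal) \<Rightarrow> (real \<Rightarrow> 'e \<Rightarrow> 'e) \<Rightarrow> (('e \<Rightarrow> real) \<times> ('e \<Rightarrow> ereal)) set" where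
  "H_dagger \<kappa> En S = {(f, g). \<exists>a b c \<mu> \<rho>. a > 0 \<and> b > 0 \<and> En \<rho> < \<infinity> \<and>
     f = (\<lambda>\<pi>. (1/2) * a * (dist \<pi> \<rho>)\<^sup>2 + b * tataru_dist \<kappa> S \<pi> \<mu> + c) \<and>
     g = (\<lambda>\<pi>. ereal a * (En \<rho> - En \<pi>)
              + ereal (- a * (\<kappa> / 2) * (dist \<pi> \<rho>)\<^sup>2 + b
                       + (1/2) * a\<^sup>2 * (dist \<pi> \<rho>)\<^sup>2 + a * b * dist \<pi> \<rho> + (1/2) * b\<^sup>2))}"

definition H_ddagger ::
  "real \<Rightarrow> ('e::metric_space \<Rightarrow> ereal) \<Rightarrow> (real \<Rightarrow> 'e \<Rightarrow> 'e) \<Rightarrow> (('e \<Rightarrow> real) \<times> ('e \<Rightarrow> ereal)) set" where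
  "H_ddagger \<kappa> En S = {(f, g). \<exists>a b c \<pi> \<gamma>. a > 0 \<and> b > 0 \<and> En \<gamma> < \<infinity> \<and>
     f = (\<lambda>\<mu>. - (1/2) * a * (dist \<gamma> \<mu>)\<^sup>2 - b * tataru_dist \<kappa> S \<mu> \<pi> + c) \<and>
     g = (\<lambda>\<mu>. ereal a * (En \<mu> - En \<gamma>)
              + ereal (a * (\<kappa> / 2) * (dist \<gamma> \<mu>)\<^sup>2 - b
                       + (1/2) * a\<^sup>2 * (dist \<gamma> \<mu>)\<^sup>2 - a * b * dist \<gamma> \<mu> - (1/2) * b\<^sup>2))}"

definition upper_semicontinuous :: "('e::topological_space \<Rightarrow> real) \<Rightarrow> bool" where
  "upper_semicontinuous u \<longleftrightarrow> (\<forall>x. \<forall>a>u x. \<forall>\<^sub>F y in nhds x. u y < a)"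

definition lower_semicontinuous :: "('e::topological_space \<Rightarrow> real) \<Rightarrow> bool" where
  "lower_semicontinuous v \<longleftrightarrow> (\<forall>x. \<forall>a<v x. \<forall>\<^sub>F y in nhds x. a < v y)"

definition viscosity_subsolution ::
  "real \<Rightarrow> (('e::metric_space \<Rightarrow> real) \<times> ('e \<Rightarrow> ereal)) set \<Rightarrow> ('e \<Rightarrow> real) \<Rightarrow> ('e \<Rightarrow> real) \<Rightarrow> bool" where
  "viscosity_subsolution l H h u \<longleftrightarrow>
     bounded (range u) \<and> upper_semicontinuous u \<and>
     (\<forall>(f, g)\<in>H. \<exists>X :: nat \<Rightarrow> 'e.
        (\<lambda>n. ereal (u (X n) - f (X n))) \<longlonglongrightarrow> (SUP x. ereal (u x - f x)) \<and>
        limsup (\<lambda>n. ereal (u (X n)) - ereal l * g (X n) - ereal (h (X n))) \<le> 0)"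

definition viscosity_supersolution ::
  "real \<Rightarrow> (('e::metric_space \<Rightarrow> real) \<times> ('e \<Rightarrow> ereal)) set \<Rightarrow> ('e \<Rightarrow> real) \<Rightarrow> ('e \<Rightarrow> real) \<Rightarrow> bool" where
  "viscosity_supersolution l H h v \<longleftrightarrow>
     bounded (range v) \<and> lower_semicontinuous v \<and>
     (\<forall>(f, g)\<in>H. \<exists>X :: nat \<Rightarrow> 'e.
        (\<lambda>n. ereal (v (X n) - f (X n))) \<longlonglongrightarrow> (INF x. ereal (v x - f x)) \<and>
        liminf (\<lambda>n. ereal (v (X n)) - ereal l * g (X n) - ereal (h (X n))) \<ge> 0)"

end

theory Submission
  imports Defs
begin

text \<open>
  Subtracting \<open>\<kappa>/2\<close> times the squared norm from the energy leaves a non-negative convex function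
  \<open>G\<close> on the set \<open>D\<close> of elements of finite energy, and \<open>D\<close> is dense (\<open>energy_decomposition\<close>,
  \<open>convex_on_convex_energy\<close>, \<open>closure_finite_energy\<close>). From these properties the principle follows in
  any real inner product space (\<open>comparison_of_near_optimisers\<close>).

  A test function for \<open>u\<close> must be centred at a point \<open>\<rho>\<close> of finite energy, one for \<open>v\<close> at such a point
  \<open>\<gamma>\<close>, while \<open>u\<close> and \<open>v\<close> are evaluated at other points \<open>\<pi>\<close> and \<open>\<mu>\<close>. Hence the variables are
  quadrupled. With \<open>P = G + (1/2) norm\<^sup>2\<close> and \<open>T\<close> the Tataru distance to a fixed point, consider
  \<open>u \<pi> - v \<mu> - (\<alpha>/2) (|\<pi> - \<rho>|\<^sup>2 + |\<rho> - \<gamma>|\<^sup>2 + |\<gamma> - \<mu>|\<^sup>2) - c (P \<rho> + P \<gamma> + T \<pi> + T \<mu>)\<close>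
  for \<open>\<rho>\<close> and \<open>\<gamma>\<close> in \<open>D\<close>.
  This is bounded above, so near-maximisers exist; because the quadratic part is smooth and \<open>P\<close> is
  convex, a near-maximiser satisfies a first order condition up to a small error: writing
  \<open>x = \<pi> - \<rho>\<close>, \<open>w = \<rho> - \<gamma>\<close>, \<open>y = \<gamma> - \<mu>\<close>, the vector \<open>\<alpha> (x - w) / c\<close> is almost a subgradient of \<open>P\<close>
  at \<open>\<rho>\<close>, and \<open>\<alpha> (w - y) / c\<close> is almost one at \<open>\<gamma>\<close> (\<open>near_minimizer_subgradient\<close>). The
  sub- and supersolution properties supply \<open>\<pi>\<close> and \<open>\<mu>\<close> as near-optimisers for the given \<open>\<rho>\<close> and
  \<open>\<gamma>\<close>, together with the equation at these points.

  In the difference of the two equations, the energy terms contribute, up to small errors, at most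
  \<open>- (|\<alpha> (x - w)|\<^sup>2 + |\<alpha> (w - y)|\<^sup>2) / c\<close> by the subgradient inequalities at \<open>\<rho>\<close> and \<open>\<gamma>\<close>
  (\<open>energy_gap\<close>). For small \<open>c\<close> this negative term absorbs everything produced by the squared
  gradients \<open>(\<alpha>\<^sup>2/2) |x|\<^sup>2 - (\<alpha>\<^sup>2/2) |y|\<^sup>2\<close> and by \<open>\<kappa>\<close> (\<open>hamiltonian_gap\<close>); what remains is
  controlled by \<open>\<alpha> (|x|\<^sup>2 + |w|\<^sup>2 + |y|\<^sup>2)\<close> and \<open>c P\<close>, which are small if first \<open>\<alpha>\<close> is chosen large and
  then \<open>c\<close> small (\<open>penalised_near_maximizer\<close>).

  The analytic input is the density of smooth compactly supported functions in \<open>L\<^sup>2\<close>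
  (\<open>closure_l2_test\<close>). It makes weak derivatives unique, hence linear, so that the gradient term of the
  energy is convex; together with integration by parts it also makes \<open>D\<close> dense.
\<close>

section \<open>Comparison for near-optimisers in an inner product space\<close>

text \<open>
  Compare \<open>r\<close> with a point on the segment towards \<open>z\<close> at parameter \<open>s\<close>: convexity bounds the growth
  of \<open>P\<close> by \<open>s\<close> times its total increment, while the quadratic terms change by their linear part and an
  error of order \<open>s\<^sup>2\<close>. Dividing by \<open>s\<close> leaves the subgradient inequality for \<open>c P\<close>, with an error that
  vanishes as \<open>s\<close> and \<open>\<eta> / s\<close> tend to zero. So near-minimality suffices for a first order condition.
\<close>

lemma near_minimizer_subgradient:
  fixes P :: "'e::real_inner \<Rightarrow> real"
  assumes P: "convex_on D P" and D: "r \<in> D" "z \<in> D"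
    and s: "0 < s" "s \<le> 1" and c: "0 \<le> c"
    and near: "\<And>z'. z' \<in> D \<Longrightarrow>
      \<alpha> / 2 * ((norm (a - r))\<^sup>2 + (norm (r - b))\<^sup>2) + c * P r
      \<le> \<alpha> / 2 * ((norm (a - z'))\<^sup>2 + (norm (z' - b))\<^sup>2) + c * P z' + \<eta>"
  shows "\<alpha> * (((a - r) - (r - b)) \<bullet> (z - r)) - \<alpha> * s * (norm (z - r))\<^sup>2 - \<eta> / s \<le> c * (P z - P r)"
proof -
  define z' where "z' = (1 - s) *\<^sub>R r + s *\<^sub>R z"
  have "z' \<in> D"
    using convex_on_imp_convex[OF P] D s unfolding z'_def by (auto intro: convexD)
  from near[OF this] have n: "\<alpha> / 2 * ((norm (a - r))\<^sup>2 + (norm (r - b))\<^sup>2) + c * P r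
      \<le> \<alpha> / 2 * ((norm (a - z'))\<^sup>2 + (norm (z' - b))\<^sup>2) + c * P z' + \<eta>" .
  have "P z' \<le> (1 - s) * P r + s * P z"
    using convex_onD[OF P, of s r z] D s by (simp add: z'_def)
  then have c1: "c * P z' \<le> c * P r + s * (c * (P z - P r))"
    using mult_left_mono[OF _ c] by (force simp: algebra_simps)
  have e1: "(norm (a - z'))\<^sup>2 = (norm (a - r))\<^sup>2 - 2 * s * ((a - r) \<bullet> (z - r)) + s\<^sup>2 * (norm (z - r))\<^sup>2"
    unfolding z'_def power2_norm_eq_inner
    by (simp add: inner_diff inner_add inner_commute power2_eq_square algebra_simps)
  have e2: "(norm (z' - b))\<^sup>2 = (norm (r - b))\<^sup>2 + 2 * s * ((r - b) \<bullet> (z - r)) + s\<^sup>2 * (norm (z - r))\<^sup>2"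
    unfolding z'_def power2_norm_eq_inner
    by (simp add: inner_diff inner_add inner_commute power2_eq_square algebra_simps)
  have "\<alpha> * s * (((a - r) - (r - b)) \<bullet> (z - r)) - \<alpha> * s\<^sup>2 * (norm (z - r))\<^sup>2 - \<eta> \<le> s * (c * (P z - P r))"
    using n c1 unfolding e1 e2 by (simp add: inner_diff_left algebra_simps)
  then have "s * (\<alpha> * (((a - r) - (r - b)) \<bullet> (z - r)) - \<alpha> * s * (norm (z - r))\<^sup>2 - \<eta> / s) \<le> s * (c * (P z - P r))"
    using s by (simp add: algebra_simps power2_eq_square)
  then show ?thesis using s by simp
qed

text \<open>
  The subgradient inequality at \<open>\<rho>\<close> tested against \<open>\<pi>\<close>, and at \<open>\<gamma>\<close> tested against \<open>\<mu>\<close>, bounds the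
  energy differences; the two remaining ones, \<open>\<rho>\<close> against \<open>\<gamma>\<close> and conversely, express monotonicity of
  the subgradient and remove the cross term \<open>\<alpha> (x - 2 w + y) \<bullet> w\<close>. Each of the four inequalities
  contributes an error \<open>s K + \<eta> / s\<close>.
\<close>

lemma energy_gap:
  fixes P :: "'e::real_inner \<Rightarrow> real" and \<pi> \<rho> \<gamma> \<mu> :: 'e
  defines "x \<equiv> \<pi> - \<rho>" and "w \<equiv> \<rho> - \<gamma>" and "y \<equiv> \<gamma> - \<mu>"
  assumes P: "convex_on D P" and D: "\<pi> \<in> D" "\<rho> \<in> D" "\<gamma> \<in> D" "\<mu> \<in> D"
    and s: "0 < s" "s \<le> 1" and c: "0 < c" and \<alpha>: "0 \<le> \<alpha>"
    and K: "\<alpha> * (norm x)\<^sup>2 \<le> K" "\<alpha> * (norm w)\<^sup>2 \<le> K" "\<alpha> * (norm y)\<^sup>2 \<le> K"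
    and near: "\<And>\<rho>' \<gamma>'. \<rho>' \<in> D \<Longrightarrow> \<gamma>' \<in> D \<Longrightarrow>
      \<alpha> / 2 * ((norm (\<pi> - \<rho>))\<^sup>2 + (norm (\<rho> - \<gamma>))\<^sup>2 + (norm (\<gamma> - \<mu>))\<^sup>2) + c * (P \<rho> + P \<gamma>)
      \<le> \<alpha> / 2 * ((norm (\<pi> - \<rho>'))\<^sup>2 + (norm (\<rho>' - \<gamma>'))\<^sup>2 + (norm (\<gamma>' - \<mu>))\<^sup>2) + c * (P \<rho>' + P \<gamma>') + \<eta>"
  shows "\<alpha> * (P \<rho> - P \<pi> + P \<gamma> - P \<mu>) \<le>
     - ((norm (\<alpha> *\<^sub>R (x - w)))\<^sup>2 + (norm (\<alpha> *\<^sub>R (w - y)))\<^sup>2) / c + 4 * \<alpha> / c * (s * K + \<eta> / s)"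
proof -
  define e where "e = s * K + \<eta> / s"
  have nr: "\<alpha> / 2 * ((norm (\<pi> - \<rho>))\<^sup>2 + (norm (\<rho> - \<gamma>))\<^sup>2) + c * P \<rho>
      \<le> \<alpha> / 2 * ((norm (\<pi> - z'))\<^sup>2 + (norm (z' - \<gamma>))\<^sup>2) + c * P z' + \<eta>" if "z' \<in> D" for z'
    using near[OF that D(3)] by (simp add: algebra_simps)
  have ng: "\<alpha> / 2 * ((norm (\<rho> - \<gamma>))\<^sup>2 + (norm (\<gamma> - \<mu>))\<^sup>2) + c * P \<gamma>
      \<le> \<alpha> / 2 * ((norm (\<rho> - z'))\<^sup>2 + (norm (z' - \<mu>))\<^sup>2) + c * P z' + \<eta>" if "z' \<in> D" for z'
    using near[OF D(2) that] by (simp add: algebra_simps)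
  have err: "\<alpha> * s * (norm \<xi>)\<^sup>2 \<le> s * K" if "\<alpha> * (norm \<xi>)\<^sup>2 \<le> K" for \<xi> :: 'e
    using mult_left_mono[OF that, of s] s by (simp add: algebra_simps)
  have sub: "\<alpha> * (((a - r) - (r - b)) \<bullet> (z - r)) - e \<le> c * (P z - P r)"
    if "r \<in> D" "z \<in> D" "\<alpha> * (norm (z - r))\<^sup>2 \<le> K"
      "\<And>z'. z' \<in> D \<Longrightarrow>
      \<alpha> / 2 * ((norm (a - r))\<^sup>2 + (norm (r - b))\<^sup>2) + c * P r
      \<le> \<alpha> / 2 * ((norm (a - z'))\<^sup>2 + (norm (z' - b))\<^sup>2) + c * P z' + \<eta>" for a r b z
    using near_minimizer_subgradient[OF P that(1,2) s _ that(4)] c err[OF that(3)]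
    unfolding e_def by auto
  have i1: "\<alpha> * ((x - w) \<bullet> x) - e \<le> c * (P \<pi> - P \<rho>)"
    using sub[OF D(2,1) _ nr] K unfolding x_def w_def by auto
  have i2: "\<alpha> * ((x - w) \<bullet> (- w)) - e \<le> c * (P \<gamma> - P \<rho>)"
    using sub[OF D(2,3) _ nr] K unfolding x_def w_def by (auto simp: norm_minus_commute)
  have i3: "\<alpha> * ((w - y) \<bullet> w) - e \<le> c * (P \<rho> - P \<gamma>)"
    using sub[OF D(3,2) _ ng] K unfolding y_def w_def by auto
  have i4: "\<alpha> * ((w - y) \<bullet> (- y)) - e \<le> c * (P \<mu> - P \<gamma>)"
    using sub[OF D(3,4) _ ng] K unfolding y_def w_def by (auto simp: norm_minus_commute)
  have "c * (P \<rho> - P \<pi> + P \<gamma> - P \<mu>) \<le> - \<alpha> * ((norm (x - w))\<^sup>2 + (norm (w - y))\<^sup>2) + 4 * e"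
    using i1 i2 i3 i4
    by (simp add: power2_norm_eq_inner inner_diff inner_commute algebra_simps)
  then have "\<alpha> * (c * (P \<rho> - P \<pi> + P \<gamma> - P \<mu>)) \<le> \<alpha> * (- \<alpha> * ((norm (x - w))\<^sup>2 + (norm (w - y))\<^sup>2) + 4 * e)"
    using \<alpha> by (rule mult_left_mono)
  then show ?thesis
    using c \<alpha> unfolding e_def[symmetric] norm_scaleR power_mult_distrib
    by (simp add: field_simps power2_eq_square)
qed

lemma inner_young:
  fixes a b :: "'e::real_inner"
  assumes "0 < c"
  shows "a \<bullet> b \<le> (norm a)\<^sup>2 / (4 * c) + c * (norm b)\<^sup>2"
proof -
  have "0 \<le> (norm (a - (2 * c) *\<^sub>R b))\<^sup>2" by simp
  also have "\<dots> = (norm a)\<^sup>2 - 4 * c * (a \<bullet> b) + 4 * c\<^sup>2 * (norm b)\<^sup>2"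
    unfolding power2_norm_eq_inner
    by (simp add: inner_diff inner_commute power2_eq_square algebra_simps)
  finally show ?thesis using assms by (simp add: field_simps power2_eq_square)
qed

text \<open>
  With \<open>X = \<alpha> (x - w)\<close> and \<open>Y = \<alpha> (w - y)\<close> one has \<open>\<alpha> x = X + \<alpha> w\<close> and \<open>\<alpha> y = \<alpha> w - Y\<close>, so the leading
  parts \<open>\<alpha> w\<close> of the two gradients cancel in the difference of their squares. Every remaining term that
  is linear in \<open>X\<close> or \<open>Y\<close> is split by Young's inequality into a quarter of \<open>|X|\<^sup>2 / c\<close> or \<open>|Y|\<^sup>2 / c\<close>,
  which the hypothesis \<open>gap\<close> absorbs, and a term with a factor \<open>c\<close>.
\<close>

lemma hamiltonian_gap:
  fixes G :: "'e::real_inner \<Rightarrow> real" and \<pi> \<rho> \<gamma> \<mu> :: 'e and \<alpha> c e \<kappa> :: real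
  defines "x \<equiv> \<pi> - \<rho>" and "w \<equiv> \<rho> - \<gamma>" and "y \<equiv> \<gamma> - \<mu>"
  defines "X \<equiv> \<alpha> *\<^sub>R (x - w)" and "Y \<equiv> \<alpha> *\<^sub>R (w - y)"
  assumes c: "0 < c" "c \<le> 1" and \<alpha>: "0 \<le> \<alpha>"
    and gap: "\<alpha> * ((G \<rho> + (norm \<rho>)\<^sup>2 / 2) - (G \<pi> + (norm \<pi>)\<^sup>2 / 2)
                + (G \<gamma> + (norm \<gamma>)\<^sup>2 / 2) - (G \<mu> + (norm \<mu>)\<^sup>2 / 2))
              \<le> - ((norm X)\<^sup>2 + (norm Y)\<^sup>2) / c + e"
  shows "\<alpha> * (G \<rho> - G \<pi>) - \<alpha> * \<kappa> * (\<pi> \<bullet> x) + \<alpha>\<^sup>2 / 2 * (norm x)\<^sup>2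
       - (\<alpha> * (G \<mu> - G \<gamma>) - \<alpha> * \<kappa> * (\<mu> \<bullet> y) + \<alpha>\<^sup>2 / 2 * (norm y)\<^sup>2)
     \<le> 2 * c * \<alpha>\<^sup>2 * (norm w)\<^sup>2 + \<bar>1 - \<kappa>\<bar> * \<alpha> * (norm (\<pi> - \<mu>) * norm w)
       + c * (1 - \<kappa>)\<^sup>2 * ((norm \<pi>)\<^sup>2 + (norm \<mu>)\<^sup>2) + e"
proof -
  have x: "\<alpha> *\<^sub>R x = X + \<alpha> *\<^sub>R w" and y: "\<alpha> *\<^sub>R y = \<alpha> *\<^sub>R w - Y"
    unfolding X_def Y_def by (auto simp: algebra_simps)
  have \<rho>: "\<rho> = \<pi> - x" and \<gamma>: "\<gamma> = \<mu> + y" by (auto simp: x_def y_def)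
  have q1: "(norm \<rho>)\<^sup>2 = (norm \<pi>)\<^sup>2 - 2 * (\<pi> \<bullet> x) + (norm x)\<^sup>2"
    unfolding \<rho> power2_norm_eq_inner by (simp add: inner_diff inner_commute algebra_simps)
  have q2: "(norm \<gamma>)\<^sup>2 = (norm \<mu>)\<^sup>2 + 2 * (\<mu> \<bullet> y) + (norm y)\<^sup>2"
    unfolding \<gamma> power2_norm_eq_inner by (simp add: inner_add inner_commute algebra_simps)
  have nn: "0 \<le> \<alpha> * (norm x)\<^sup>2" "0 \<le> \<alpha> * (norm y)\<^sup>2" using \<alpha> by auto
  have g1: "\<alpha> * (G \<rho> - G \<pi> + G \<gamma> - G \<mu>)
      \<le> - ((norm X)\<^sup>2 + (norm Y)\<^sup>2) / c + e + (\<alpha> * (\<pi> \<bullet> x) - \<alpha> * (\<mu> \<bullet> y))"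
    using gap nn unfolding q1 q2 by (simp add: algebra_simps add_divide_distrib diff_divide_distrib)
  have "\<alpha> * (\<pi> \<bullet> x) = \<pi> \<bullet> (\<alpha> *\<^sub>R x)" "\<alpha> * (\<mu> \<bullet> y) = \<mu> \<bullet> (\<alpha> *\<^sub>R y)" by auto
  then have d: "\<alpha> * (\<pi> \<bullet> x) - \<alpha> * (\<mu> \<bullet> y) = \<alpha> * ((\<pi> - \<mu>) \<bullet> w) + \<pi> \<bullet> X + \<mu> \<bullet> Y"
    unfolding x y by (simp add: inner_add inner_diff algebra_simps)
  have "\<alpha>\<^sup>2 * (norm x)\<^sup>2 = (norm (\<alpha> *\<^sub>R x))\<^sup>2" "\<alpha>\<^sup>2 * (norm y)\<^sup>2 = (norm (\<alpha> *\<^sub>R y))\<^sup>2"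
    by (auto simp: power_mult_distrib)
  then have sq: "\<alpha>\<^sup>2 * (norm x)\<^sup>2 - \<alpha>\<^sup>2 * (norm y)\<^sup>2
      = (norm X)\<^sup>2 - (norm Y)\<^sup>2 + 2 * (X \<bullet> (\<alpha> *\<^sub>R w)) + 2 * (Y \<bullet> (\<alpha> *\<^sub>R w))"
    unfolding x y power2_norm_eq_inner
    by (simp add: inner_add inner_diff inner_commute algebra_simps)
  have y1: "X \<bullet> (\<alpha> *\<^sub>R w) \<le> (norm X)\<^sup>2 / (4 * c) + c * (\<alpha>\<^sup>2 * (norm w)\<^sup>2)"
    using inner_young[OF c(1), of X "\<alpha> *\<^sub>R w"] by (simp add: power_mult_distrib)
  have y2: "Y \<bullet> (\<alpha> *\<^sub>R w) \<le> (norm Y)\<^sup>2 / (4 * c) + c * (\<alpha>\<^sup>2 * (norm w)\<^sup>2)"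
    using inner_young[OF c(1), of Y "\<alpha> *\<^sub>R w"] by (simp add: power_mult_distrib)
  have y3: "(1 - \<kappa>) * (\<pi> \<bullet> X) \<le> (norm X)\<^sup>2 / (4 * c) + c * ((1 - \<kappa>)\<^sup>2 * (norm \<pi>)\<^sup>2)"
    using inner_young[OF c(1), of X "(1 - \<kappa>) *\<^sub>R \<pi>"] by (simp add: power_mult_distrib inner_commute)
  have y4: "(1 - \<kappa>) * (\<mu> \<bullet> Y) \<le> (norm Y)\<^sup>2 / (4 * c) + c * ((1 - \<kappa>)\<^sup>2 * (norm \<mu>)\<^sup>2)"
    using inner_young[OF c(1), of Y "(1 - \<kappa>) *\<^sub>R \<mu>"] by (simp add: power_mult_distrib inner_commute)
  have "(1 - \<kappa>) * ((\<pi> - \<mu>) \<bullet> w) \<le> \<bar>1 - \<kappa>\<bar> * \<bar>(\<pi> - \<mu>) \<bullet> w\<bar>"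
    by (metis abs_ge_self abs_mult)
  also have "\<dots> \<le> \<bar>1 - \<kappa>\<bar> * (norm (\<pi> - \<mu>) * norm w)"
    by (intro mult_left_mono Cauchy_Schwarz_ineq2) auto
  finally have y5: "\<alpha> * ((1 - \<kappa>) * ((\<pi> - \<mu>) \<bullet> w)) \<le> \<bar>1 - \<kappa>\<bar> * \<alpha> * (norm (\<pi> - \<mu>) * norm w)"
    using mult_left_mono[OF _ \<alpha>] by (fastforce simp: algebra_simps)
  have X2: "(norm X)\<^sup>2 / 2 + (norm X)\<^sup>2 / (4 * c) + (norm X)\<^sup>2 / (4 * c) \<le> (norm X)\<^sup>2 / c"
  proof -
    have "(norm X)\<^sup>2 * c \<le> (norm X)\<^sup>2 * 1" by (rule mult_left_mono) (use c in auto)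
    then show ?thesis using c by (simp add: field_simps)
  qed
  have Y2: "- (norm Y)\<^sup>2 / 2 + (norm Y)\<^sup>2 / (4 * c) + (norm Y)\<^sup>2 / (4 * c) \<le> (norm Y)\<^sup>2 / c"
    using c by (simp add: field_simps)
  have e: "\<alpha> * (G \<rho> - G \<pi>) - \<alpha> * \<kappa> * (\<pi> \<bullet> x) + \<alpha>\<^sup>2 / 2 * (norm x)\<^sup>2
       - (\<alpha> * (G \<mu> - G \<gamma>) - \<alpha> * \<kappa> * (\<mu> \<bullet> y) + \<alpha>\<^sup>2 / 2 * (norm y)\<^sup>2)
     = \<alpha> * (G \<rho> - G \<pi> + G \<gamma> - G \<mu>) - \<kappa> * (\<alpha> * (\<pi> \<bullet> x) - \<alpha> * (\<mu> \<bullet> y))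
       + (\<alpha>\<^sup>2 * (norm x)\<^sup>2 - \<alpha>\<^sup>2 * (norm y)\<^sup>2) / 2"
    by (simp add: field_simps)
  show ?thesis
    using g1 y1 y2 y3 y4 y5 X2 Y2 unfolding e sq d
    by (simp add: add_divide_distrib diff_divide_distrib algebra_simps)
qed

text \<open>
  The supremum of \<open>A - \<alpha> Q\<close> decreases in \<open>\<alpha>\<close> and stays above \<open>m\<close>, so along \<open>\<alpha> = 2\<^sup>k\<close> it must at some
  step drop by at most \<open>\<theta>\<close>. For such an \<open>\<alpha>\<close>, replacing \<open>\<alpha>\<close> by \<open>\<alpha> / 2\<close> can gain little, which forces
  \<open>\<alpha> Q\<close> to be small at near-maximisers. A small weight \<open>c\<close> on \<open>R\<close> changes the supremum by little, which
  forces \<open>c R\<close> to be small.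
\<close>

lemma penalised_near_maximizer:
  fixes A Q R :: "'z \<Rightarrow> real"
  assumes A: "\<And>z. z \<in> Z \<Longrightarrow> A z \<le> B" and Q: "\<And>z. z \<in> Z \<Longrightarrow> 0 \<le> Q z" and R: "\<And>z. z \<in> Z \<Longrightarrow> 0 \<le> R z"
    and m: "\<And>\<alpha> e. 0 < \<alpha> \<Longrightarrow> 0 < e \<Longrightarrow> \<exists>z\<in>Z. m - e \<le> A z - \<alpha> * Q z"
    and \<theta>: "0 < \<theta>"
  obtains \<alpha> c0 where "1 \<le> \<alpha>" "0 < c0"
    "\<And>c z. 0 < c \<Longrightarrow> c \<le> c0 \<Longrightarrow> z \<in> Z \<Longrightarrow>
       (\<And>z'. z' \<in> Z \<Longrightarrow> A z' - \<alpha> * Q z' - c * R z' \<le> A z - \<alpha> * Q z - c * R z + \<theta>) \<Longrightarrow>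
       m - 3 * \<theta> \<le> A z \<and> \<alpha> * Q z \<le> 8 * \<theta> \<and> c * R z \<le> 4 * \<theta>"
proof -
  define M where "M \<alpha> = (SUP z\<in>Z. A z - \<alpha> * Q z)" for \<alpha>
  have bdd: "bdd_above ((\<lambda>z. A z - \<alpha> * Q z) ` Z)" if "0 < \<alpha>" for \<alpha>
  proof (rule bdd_aboveI2)
    fix z assume "z \<in> Z"
    then show "A z - \<alpha> * Q z \<le> B" using A Q that by (smt (verit) mult_nonneg_nonneg)
  qed
  have upper: "A z - \<alpha> * Q z \<le> M \<alpha>" if "0 < \<alpha>" "z \<in> Z" for \<alpha> z
    unfolding M_def using bdd that by (intro cSUP_upper)
  have lower: "m \<le> M \<alpha>" if "0 < \<alpha>" for \<alpha>
  proof (rule field_le_epsilon)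
    fix e :: real assume "0 < e"
    from m[OF that this] obtain z where "z \<in> Z" "m - e \<le> A z - \<alpha> * Q z" by auto
    then show "m \<le> M \<alpha> + e" using upper[OF that] by fastforce
  qed
  have ne: "Z \<noteq> {}" using m[of 1 1] by auto
  \<comment> \<open>If every doubling of \<open>\<alpha>\<close> lowered \<open>M\<close> by more than \<open>\<theta>\<close>, then \<open>M\<close> would fall below \<open>m\<close>.\<close>
  have "\<exists>k. M (2 ^ k) \<le> M (2 ^ Suc k) + \<theta>"
  proof (rule ccontr)
    assume "\<not> ?thesis"
    then have step: "M (2 ^ Suc k) < M (2 ^ k) - \<theta>" for k by (auto simp: not_le algebra_simps)
    have "M (2 ^ k) \<le> M 1 - k * \<theta>" for k
    proof (induction k)
      case (Suc k) then show ?case using step[of k] by (simp add: algebra_simps)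
    qed simp
    moreover obtain k :: nat where "(M 1 - m) / \<theta> < k" using reals_Archimedean2 by blast
    ultimately show False using lower[of "2 ^ k"] \<theta> by (simp add: field_simps) (smt (verit))
  qed
  then obtain k where k: "M (2 ^ k) \<le> M (2 ^ Suc k) + \<theta>" by blast
  define \<alpha> :: real where "\<alpha> = 2 ^ Suc k"
  have \<alpha>: "1 \<le> \<alpha>" unfolding \<alpha>_def by (rule one_le_power) simp
  have half: "M (\<alpha> / 2) \<le> M \<alpha> + \<theta>" using k by (simp add: \<alpha>_def)
  have "M \<alpha> - \<theta> < M \<alpha>" using \<theta> by simp
  then obtain z0 where z0: "z0 \<in> Z" "M \<alpha> - \<theta> < A z0 - \<alpha> * Q z0"
    using less_cSUP_iff[OF ne bdd[of \<alpha>], of "M \<alpha> - \<theta>"] \<alpha> unfolding M_def by auto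
  define c0 where "c0 = \<theta> / (R z0 + 1)"
  have c0: "0 < c0" using \<theta> R[OF z0(1)] by (simp add: c0_def)
  show ?thesis
  proof (rule that[OF \<alpha> c0])
    fix c z assume c: "0 < c" "c \<le> c0" and z: "z \<in> Z"
      and near: "\<And>z'. z' \<in> Z \<Longrightarrow> A z' - \<alpha> * Q z' - c * R z' \<le> A z - \<alpha> * Q z - c * R z + \<theta>"
    have "c * R z0 \<le> c0 * (R z0 + 1)" using c R[OF z0(1)] by (intro mult_mono) auto
    also have "\<dots> = \<theta>" using R[OF z0(1)] by (simp add: c0_def)
    finally have 1: "M \<alpha> - 3 * \<theta> \<le> A z - \<alpha> * Q z - c * R z" using near[OF z0(1)] z0(2) by linarith
    have 2: "A z - \<alpha> / 2 * Q z \<le> M \<alpha> + \<theta>" using upper[of "\<alpha> / 2", OF _ z] half \<alpha> by linarith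
    have "0 \<le> \<alpha> * Q z" "0 \<le> c * R z" using Q[OF z] R[OF z] \<alpha> c by auto
    then show "m - 3 * \<theta> \<le> A z \<and> \<alpha> * Q z \<le> 8 * \<theta> \<and> c * R z \<le> 4 * \<theta>"
      using 1 2 lower[of \<alpha>] \<alpha> by (auto simp: field_simps)
  qed
qed


lemma convex_on_norm_square:
  fixes D :: "'e::real_inner set"
  assumes "convex D"
  shows "convex_on D (\<lambda>x. (norm x)\<^sup>2)"
proof (rule convex_onI[OF _ assms])
  fix t :: real and x y :: 'e assume t: "0 < t" "t < 1"
  have "(1 - t) * (norm x)\<^sup>2 + t * (norm y)\<^sup>2 - (norm ((1 - t) *\<^sub>R x + t *\<^sub>R y))\<^sup>2
      = t * (1 - t) * (norm (x - y))\<^sup>2"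
    unfolding power2_norm_eq_inner by (simp add: inner_add inner_diff inner_commute algebra_simps)
  moreover have "0 \<le> t * (1 - t) * (norm (x - y))\<^sup>2" using t by simp
  ultimately show "(norm ((1 - t) *\<^sub>R x + t *\<^sub>R y))\<^sup>2 \<le> (1 - t) * (norm x)\<^sup>2 + t * (norm y)\<^sup>2"
    by linarith
qed

text \<open>
  Here \<open>sub\<close> and \<open>super\<close> are what the viscosity properties say about a single, sufficiently late member of
  the optimising sequence, in terms of the convex part \<open>G\<close> of the energy. The parameters are fixed in the
  order \<open>\<theta>\<close> (accuracy), \<open>\<alpha>\<close>, \<open>c\<close>, \<open>s\<close> (step in the subgradient inequality), \<open>\<eta>\<close> (near-optimality), each
  small, or for \<open>\<alpha>\<close> large, depending on the earlier ones. The weight \<open>c\<close> also serves as the coefficient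
  of the Tataru term.
\<close>

lemma comparison_of_near_optimisers:
  fixes u v h1 h2 T G :: "'e::real_inner \<Rightarrow> real" and \<kappa> l S :: real
  assumes dense: "closure D = UNIV" and G: "convex_on D G" "\<And>x. x \<in> D \<Longrightarrow> 0 \<le> G x"
    and T: "\<And>x. 0 \<le> T x"
    and bdd: "bounded (range u)" "bounded (range v)"
    and l: "0 < l" and h1: "uniformly_continuous_on UNIV h1" and S: "\<And>x. h1 x - h2 x \<le> S"
    and sub: "\<And>a c \<rho> \<eta>. 0 < a \<Longrightarrow> 0 < c \<Longrightarrow> \<rho> \<in> D \<Longrightarrow> 0 < \<eta> \<Longrightarrow> \<exists>\<pi>\<in>D.
      (\<forall>\<pi>'. u \<pi>' - (a / 2 * (norm (\<pi>' - \<rho>))\<^sup>2 + c * T \<pi>') \<le> u \<pi> - (a / 2 * (norm (\<pi> - \<rho>))\<^sup>2 + c * T \<pi>) + \<eta>) \<and>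
      u \<pi> \<le> h1 \<pi> + l * (a * (G \<rho> - G \<pi>) - a * \<kappa> * (\<pi> \<bullet> (\<pi> - \<rho>)) + a\<^sup>2 / 2 * (norm (\<pi> - \<rho>))\<^sup>2
             + (c + a * c * norm (\<pi> - \<rho>) + c\<^sup>2 / 2)) + \<eta>"
    and super: "\<And>a c \<gamma> \<eta>. 0 < a \<Longrightarrow> 0 < c \<Longrightarrow> \<gamma> \<in> D \<Longrightarrow> 0 < \<eta> \<Longrightarrow> \<exists>\<mu>\<in>D.
      (\<forall>\<mu>'. v \<mu> + (a / 2 * (norm (\<gamma> - \<mu>))\<^sup>2 + c * T \<mu>) - \<eta> \<le> v \<mu>' + (a / 2 * (norm (\<gamma> - \<mu>'))\<^sup>2 + c * T \<mu>')) \<and>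
      h2 \<mu> + l * (a * (G \<mu> - G \<gamma>) - a * \<kappa> * (\<mu> \<bullet> (\<gamma> - \<mu>)) + a\<^sup>2 / 2 * (norm (\<gamma> - \<mu>))\<^sup>2
             - (c + a * c * norm (\<gamma> - \<mu>) + c\<^sup>2 / 2)) - \<eta> \<le> v \<mu>"
  shows "u x0 - v x0 \<le> S"
proof (rule field_le_epsilon)
  fix \<tau> :: real assume \<tau>: "0 < \<tau>"
  define P where "P x = G x + (norm x)\<^sup>2 / 2" for x
  have convD: "convex D" using G(1) by (rule convex_on_imp_convex)
  have P0: "(norm x)\<^sup>2 / 2 \<le> P x" if "x \<in> D" for x using G(2)[OF that] by (simp add: P_def)
  have convP: "convex_on D P"
  proof -
    have "convex_on D (\<lambda>x. (1 / 2) * (norm x)\<^sup>2)"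
      by (intro convex_on_cmul convex_on_norm_square convD) simp
    then show ?thesis using convex_on_add[OF G(1)] by (simp add: P_def[abs_def])
  qed
  obtain \<delta> where \<delta>: "0 < \<delta>" "\<And>x y. norm (x - y) < \<delta> \<Longrightarrow> \<bar>h1 x - h1 y\<bar> < \<tau> / 2"
    using h1 \<tau> unfolding uniformly_continuous_on_def dist_norm real_norm_def
    by (metis UNIV_I half_gt_zero)
  \<comment> \<open>\<open>C \<theta>\<close> will collect all the errors: \<open>54 = 32 + 21 + 1\<close> from \<open>t1\<close>, \<open>t4\<close> and \<open>e\<close>, the terms with \<open>\<kappa>\<close>
    from \<open>t2\<close> and \<open>t3\<close>, and \<open>5\<close> from the passage to near-maximisers.\<close>
  define C where "C = l * (54 + 32 * \<bar>1 - \<kappa>\<bar> + 96 * (1 - \<kappa>)\<^sup>2) + 5"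
  have C: "0 < C" unfolding C_def using l by (intro add_nonneg_pos mult_nonneg_nonneg add_nonneg_nonneg) auto
  define \<theta> where "\<theta> = Min {1, \<tau> / 2 / C, \<delta>\<^sup>2 / 49}"
  have \<theta>: "0 < \<theta>" "\<theta> \<le> 1" "\<theta> \<le> \<tau> / 2 / C" "\<theta> \<le> \<delta>\<^sup>2 / 49"
    unfolding \<theta>_def using \<tau> C \<delta> by auto
  have \<theta>C: "C * \<theta> \<le> \<tau> / 2" using \<theta>(3) C by (simp add: field_simps)
  have \<theta>\<delta>: "48 * \<theta> < \<delta>\<^sup>2" using \<theta>(4,1) by simp

  define Z where "Z = (UNIV :: 'e set) \<times> D \<times> D \<times> (UNIV :: 'e set)"
  define A where "A = (\<lambda>(\<pi>::'e, \<rho>::'e, \<gamma>::'e, \<mu>). u \<pi> - v \<mu>)"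
  define Q where "Q = (\<lambda>(\<pi>::'e, \<rho>, \<gamma>, \<mu>). ((norm (\<pi> - \<rho>))\<^sup>2 + (norm (\<rho> - \<gamma>))\<^sup>2 + (norm (\<gamma> - \<mu>))\<^sup>2) / 2)"
  define R where "R = (\<lambda>(\<pi>, \<rho>, \<gamma>, \<mu>). P \<rho> + P \<gamma> + T \<pi> + T \<mu>)"
  obtain Bu Bv where B: "\<And>x. \<bar>u x\<bar> \<le> Bu" "\<And>x. \<bar>v x\<bar> \<le> Bv"
    using bdd unfolding bounded_iff by auto
  have A: "A z \<le> Bu + Bv" for z
    using B(1)[of "fst z"] B(2)[of "snd (snd (snd z))"] unfolding A_def by (auto split: prod.splits)
  have Q: "0 \<le> Q z" for z unfolding Q_def by (auto split: prod.splits)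
  have Ppos: "0 \<le> P x" if "x \<in> D" for x using P0[OF that] order_trans[of 0 "(norm x)\<^sup>2 / 2"] by simp
  have R: "0 \<le> R z" if "z \<in> Z" for z
    using that T Ppos unfolding R_def Z_def by (auto split: prod.splits)
  have start: "\<exists>z\<in>Z. (u x0 - v x0) - e \<le> A z - \<alpha> * Q z" if "0 < \<alpha>" "0 < e" for \<alpha> e
  proof -
    have q: "0 < e / \<alpha>" using that by simp
    have "x0 \<in> closure D" using dense by simp
    then obtain \<sigma> where \<sigma>: "\<sigma> \<in> D" "dist \<sigma> x0 < sqrt (e / \<alpha>)"
      using q unfolding closure_approachable by (meson real_sqrt_gt_zero)
    have "(norm (x0 - \<sigma>))\<^sup>2 < (sqrt (e / \<alpha>))\<^sup>2"
      using \<sigma>(2) by (intro power_strict_mono) (auto simp: dist_norm norm_minus_commute)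
    then have "(norm (x0 - \<sigma>))\<^sup>2 < e / \<alpha>" using q by simp
    then have "\<alpha> * (norm (x0 - \<sigma>))\<^sup>2 \<le> e" using that by (simp add: field_simps)
    then show ?thesis
      using \<sigma>(1) by (intro bexI[of _ "(x0, \<sigma>, \<sigma>, x0)"]) (auto simp: A_def Q_def Z_def norm_minus_commute)
  qed
  obtain \<alpha> c0 where \<alpha>: "1 \<le> \<alpha>" and c0: "0 < c0" and
    near: "\<And>c z. 0 < c \<Longrightarrow> c \<le> c0 \<Longrightarrow> z \<in> Z \<Longrightarrow>
       (\<And>z'. z' \<in> Z \<Longrightarrow> A z' - \<alpha> * Q z' - c * R z' \<le> A z - \<alpha> * Q z - c * R z + \<theta>) \<Longrightarrow>
       (u x0 - v x0) - 3 * \<theta> \<le> A z \<and> \<alpha> * Q z \<le> 8 * \<theta> \<and> c * R z \<le> 4 * \<theta>"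
    using penalised_near_maximizer[of Z A "Bu + Bv" Q R "u x0 - v x0" \<theta>] A Q R start \<theta>(1) by blast
  define c where "c = Min {c0, \<theta> / \<alpha>, 1/2}"
  have c: "0 < c" "c \<le> c0" "c \<le> \<theta> / \<alpha>" "c \<le> 1" unfolding c_def using c0 \<theta> \<alpha> by auto
  have \<alpha>c: "\<alpha> * c \<le> \<theta>" using c(3) \<alpha> by (simp add: field_simps)
  have \<alpha>_scale: "r \<le> \<alpha> * r" if "0 \<le> r" for r using mult_right_mono[OF \<alpha> that] by simp
  have c\<theta>: "c \<le> \<theta>" using \<alpha>c \<alpha>_scale[of c] c(1) by linarith
  \<comment> \<open>The subgradient error \<open>16 s \<theta> + 3 \<eta> / s\<close> is at most \<open>17 s\<close> and enters with the factor \<open>4 \<alpha> / c\<close>.\<close>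
  define s where "s = Min {1, c * \<theta> / (4 * \<alpha> * 17)}"
  have s: "0 < s" "s \<le> 1" "s \<le> c * \<theta> / (4 * \<alpha> * 17)" unfolding s_def using c \<theta> \<alpha> by auto
  define \<eta> where "\<eta> = Min {\<theta> / 3, s\<^sup>2 / 3}"
  have \<eta>: "0 < \<eta>" "3 * \<eta> \<le> \<theta>" "3 * \<eta> \<le> s\<^sup>2" unfolding \<eta>_def using \<theta> s by auto

  define J where "J z = A z - \<alpha> * Q z - c * R z" for z
  have J_bdd: "bdd_above (J ` Z)"
  proof (rule bdd_aboveI2)
    fix z assume "z \<in> Z"
    then have "0 \<le> \<alpha> * Q z" "0 \<le> c * R z" using Q R \<alpha> c by auto
    then show "J z \<le> Bu + Bv" using A[of z] unfolding J_def by linarith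
  qed
  have "Z \<noteq> {}" using start[of 1 1] by auto
  then obtain z0 where z0: "z0 \<in> Z" "(SUP z\<in>Z. J z) - \<eta> < J z0"
    using less_cSUP_iff[OF _ J_bdd, of "(SUP z\<in>Z. J z) - \<eta>"] \<eta> by auto
  have z0_near: "J z \<le> J z0 + \<eta>" if "z \<in> Z" for z
    using cSUP_upper[OF that J_bdd] z0(2) by linarith
  obtain \<pi>0 \<rho> \<gamma> \<mu>0 where z0_eq: "z0 = (\<pi>0, \<rho>, \<gamma>, \<mu>0)" by (cases z0)
  have D: "\<rho> \<in> D" "\<gamma> \<in> D" using z0(1) by (auto simp: z0_eq Z_def)
  \<comment> \<open>Only the centres \<open>\<rho>\<close> and \<open>\<gamma>\<close> of the first near-maximiser are kept. The outer points are replaced by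
    those that the sub- and supersolution properties provide, at the cost of \<open>2 \<eta>\<close> in near-maximality.\<close>
  obtain \<pi> where \<pi>: "\<pi> \<in> D"
    "\<And>\<pi>'. u \<pi>' - (\<alpha> / 2 * (norm (\<pi>' - \<rho>))\<^sup>2 + c * T \<pi>') \<le> u \<pi> - (\<alpha> / 2 * (norm (\<pi> - \<rho>))\<^sup>2 + c * T \<pi>) + \<eta>"
    "u \<pi> \<le> h1 \<pi> + l * (\<alpha> * (G \<rho> - G \<pi>) - \<alpha> * \<kappa> * (\<pi> \<bullet> (\<pi> - \<rho>)) + \<alpha>\<^sup>2 / 2 * (norm (\<pi> - \<rho>))\<^sup>2
             + (c + \<alpha> * c * norm (\<pi> - \<rho>) + c\<^sup>2 / 2)) + \<eta>"
    using sub[OF _ c(1) D(1) \<eta>(1), of \<alpha>] \<alpha> by auto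
  obtain \<mu> where \<mu>: "\<mu> \<in> D"
    "\<And>\<mu>'. v \<mu> + (\<alpha> / 2 * (norm (\<gamma> - \<mu>))\<^sup>2 + c * T \<mu>) - \<eta> \<le> v \<mu>' + (\<alpha> / 2 * (norm (\<gamma> - \<mu>'))\<^sup>2 + c * T \<mu>')"
    "h2 \<mu> + l * (\<alpha> * (G \<mu> - G \<gamma>) - \<alpha> * \<kappa> * (\<mu> \<bullet> (\<gamma> - \<mu>)) + \<alpha>\<^sup>2 / 2 * (norm (\<gamma> - \<mu>))\<^sup>2
             - (c + \<alpha> * c * norm (\<gamma> - \<mu>) + c\<^sup>2 / 2)) - \<eta> \<le> v \<mu>"
    using super[OF _ c(1) D(2) \<eta>(1), of \<alpha>] \<alpha> by auto
  define z where "z = (\<pi>, \<rho>, \<gamma>, \<mu>)"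
  have zZ: "z \<in> Z" using D by (auto simp: z_def Z_def)
  have "J z0 \<le> J z + 2 * \<eta>"
    using \<pi>(2)[of \<pi>0] \<mu>(2)[of \<mu>0]
    by (simp add: J_def z0_eq z_def A_def Q_def R_def algebra_simps add_divide_distrib)
  then have z_near: "J z' \<le> J z + 3 * \<eta>" if "z' \<in> Z" for z'
    using z0_near[OF that] by linarith
  have "(u x0 - v x0) - 3 * \<theta> \<le> A z \<and> \<alpha> * Q z \<le> 8 * \<theta> \<and> c * R z \<le> 4 * \<theta>"
  proof (rule near[OF c(1,2) zZ])
    fix z' assume "z' \<in> Z"
    from z_near[OF this] show "A z' - \<alpha> * Q z' - c * R z' \<le> A z - \<alpha> * Q z - c * R z + \<theta>"
      using \<eta>(2) unfolding J_def by linarith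
  qed
  then have zA: "(u x0 - v x0) - 3 * \<theta> \<le> u \<pi> - v \<mu>" and zQ: "\<alpha> * Q z \<le> 8 * \<theta>" and zR: "c * R z \<le> 4 * \<theta>"
    by (auto simp: A_def z_def)

  define x w y where "x = \<pi> - \<rho>" and "w = \<rho> - \<gamma>" and "y = \<gamma> - \<mu>"
  have Qsum: "\<alpha> * (norm x)\<^sup>2 + \<alpha> * (norm w)\<^sup>2 + \<alpha> * (norm y)\<^sup>2 \<le> 16 * \<theta>"
    using zQ by (simp add: Q_def z_def x_def w_def y_def algebra_simps add_divide_distrib)
  have nn: "0 \<le> \<alpha> * (norm x)\<^sup>2" "0 \<le> \<alpha> * (norm w)\<^sup>2" "0 \<le> \<alpha> * (norm y)\<^sup>2" using \<alpha> by auto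
  have gap: "\<alpha> * (P \<rho> - P \<pi> + P \<gamma> - P \<mu>) \<le>
     - ((norm (\<alpha> *\<^sub>R (x - w)))\<^sup>2 + (norm (\<alpha> *\<^sub>R (w - y)))\<^sup>2) / c + 4 * \<alpha> / c * (s * (16 * \<theta>) + 3 * \<eta> / s)"
    unfolding x_def w_def y_def
  proof (rule energy_gap[OF convP \<pi>(1) D \<mu>(1) s(1,2) c(1)])
    show "0 \<le> \<alpha>" using \<alpha> by simp
    show "\<alpha> * (norm (\<pi> - \<rho>))\<^sup>2 \<le> 16 * \<theta>" "\<alpha> * (norm (\<rho> - \<gamma>))\<^sup>2 \<le> 16 * \<theta>" "\<alpha> * (norm (\<gamma> - \<mu>))\<^sup>2 \<le> 16 * \<theta>"
      using Qsum nn unfolding x_def w_def y_def by linarith+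
    fix \<rho>' \<gamma>' assume "\<rho>' \<in> D" "\<gamma>' \<in> D"
    then have "(\<pi>, \<rho>', \<gamma>', \<mu>) \<in> Z" by (auto simp: Z_def)
    from z_near[OF this]
    show "\<alpha> / 2 * ((norm (\<pi> - \<rho>))\<^sup>2 + (norm (\<rho> - \<gamma>))\<^sup>2 + (norm (\<gamma> - \<mu>))\<^sup>2) + c * (P \<rho> + P \<gamma>)
      \<le> \<alpha> / 2 * ((norm (\<pi> - \<rho>'))\<^sup>2 + (norm (\<rho>' - \<gamma>'))\<^sup>2 + (norm (\<gamma>' - \<mu>))\<^sup>2) + c * (P \<rho>' + P \<gamma>') + 3 * \<eta>"
      by (simp add: J_def z_def A_def Q_def R_def algebra_simps add_divide_distrib)
  qed
  define e where "e = 4 * \<alpha> / c * (s * (16 * \<theta>) + 3 * \<eta> / s)"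
  have e: "e \<le> \<theta>"
  proof -
    have "3 * \<eta> / s \<le> s" using \<eta>(3) s(1) by (simp add: field_simps power2_eq_square)
    moreover have "s * (16 * \<theta>) \<le> s * 16" using s \<theta> by (intro mult_left_mono) auto
    moreover have "17 * s \<le> c * \<theta> / (4 * \<alpha>)" using s(3) \<alpha> by (simp add: field_simps)
    ultimately have "s * (16 * \<theta>) + 3 * \<eta> / s \<le> c * \<theta> / (4 * \<alpha>)" by linarith
    then have "e \<le> 4 * \<alpha> / c * (c * \<theta> / (4 * \<alpha>))"
      unfolding e_def using \<alpha> c by (intro mult_left_mono) auto
    also have "\<dots> = \<theta>" using \<alpha> c by simp
    finally show ?thesis .
  qed
  have ham: "\<alpha> * (G \<rho> - G \<pi>) - \<alpha> * \<kappa> * (\<pi> \<bullet> x) + \<alpha>\<^sup>2 / 2 * (norm x)\<^sup>2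
       - (\<alpha> * (G \<mu> - G \<gamma>) - \<alpha> * \<kappa> * (\<mu> \<bullet> y) + \<alpha>\<^sup>2 / 2 * (norm y)\<^sup>2)
     \<le> 2 * c * \<alpha>\<^sup>2 * (norm w)\<^sup>2 + \<bar>1 - \<kappa>\<bar> * \<alpha> * (norm (\<pi> - \<mu>) * norm w)
       + c * (1 - \<kappa>)\<^sup>2 * ((norm \<pi>)\<^sup>2 + (norm \<mu>)\<^sup>2) + e"
    unfolding x_def w_def y_def
    by (rule hamiltonian_gap) (use c \<alpha> gap in \<open>auto simp: e_def P_def x_def w_def y_def\<close>)
  have t1: "2 * c * \<alpha>\<^sup>2 * (norm w)\<^sup>2 \<le> 32 * \<theta>"
  proof -
    have "(\<alpha> * c) * (\<alpha> * (norm w)\<^sup>2) \<le> 1 * (16 * \<theta>)"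
    proof (rule mult_mono)
      show "\<alpha> * c \<le> 1" using \<alpha>c \<theta>(2) by linarith
      show "\<alpha> * (norm w)\<^sup>2 \<le> 16 * \<theta>" using Qsum nn by linarith
    qed (use \<alpha> in auto)
    then show ?thesis by (simp add: power2_eq_square algebra_simps)
  qed
  have t2: "\<alpha> * (norm (\<pi> - \<mu>) * norm w) \<le> 32 * \<theta>"
  proof -
    have "norm (\<pi> - \<mu>) \<le> norm x + norm w + norm y"
      unfolding x_def w_def y_def by (smt (verit) norm_triangle_ineq diff_add_eq add_diff_eq diff_add_cancel)
    then have "norm (\<pi> - \<mu>) * norm w \<le> (norm x + norm w + norm y) * norm w" by (rule mult_right_mono) auto
    also have "\<dots> \<le> 2 * ((norm x)\<^sup>2 + (norm w)\<^sup>2 + (norm y)\<^sup>2)"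
    proof -
      have "(a + b + c) * b \<le> 2 * (a\<^sup>2 + b\<^sup>2 + c\<^sup>2)" for a b c :: real
      proof -
        have "0 \<le> (a - b / 2)\<^sup>2 + (c - b / 2)\<^sup>2 + a\<^sup>2 + b\<^sup>2 / 2 + c\<^sup>2" by simp
        then show ?thesis by (simp add: power2_eq_square field_simps)
      qed
      then show ?thesis by blast
    qed
    finally have "\<alpha> * (norm (\<pi> - \<mu>) * norm w) \<le> \<alpha> * (2 * ((norm x)\<^sup>2 + (norm w)\<^sup>2 + (norm y)\<^sup>2))"
      using \<alpha> by (intro mult_left_mono) auto
    then show ?thesis using Qsum by (simp add: algebra_simps)
  qed
  have cn: "c * (norm a)\<^sup>2 \<le> 16 * \<theta> + 32 * \<theta>"
    if "c * (norm b)\<^sup>2 \<le> 8 * \<theta>" "\<alpha> * (norm (a - b))\<^sup>2 \<le> 16 * \<theta>" for a b :: 'e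
  proof -
    have "norm a \<le> norm b + norm (a - b)" by (metis add.commute diff_add_cancel norm_triangle_ineq)
    then have "(norm a)\<^sup>2 \<le> (norm b + norm (a - b))\<^sup>2" by (rule power_mono) auto
    also have "\<dots> \<le> 2 * (norm b)\<^sup>2 + 2 * (norm (a - b))\<^sup>2"
      using sum_squares_bound[of "norm b" "norm (a - b)"] by (simp add: power2_sum)
    finally have "c * (norm a)\<^sup>2 \<le> c * (2 * (norm b)\<^sup>2 + 2 * (norm (a - b))\<^sup>2)"
      using c by (intro mult_left_mono) auto
    moreover have "c * (norm (a - b))\<^sup>2 \<le> \<alpha> * (norm (a - b))\<^sup>2" using c \<alpha> by (intro mult_right_mono) auto
    ultimately show ?thesis using that by (simp add: algebra_simps)
  qed
  have cb: "c * (norm b)\<^sup>2 \<le> 8 * \<theta>" if "b = \<rho> \<or> b = \<gamma>" for b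
  proof -
    have "P b \<le> R z" using that Ppos D T by (auto simp: R_def z_def add_nonneg_nonneg)
    then have "c * ((norm b)\<^sup>2 / 2) \<le> c * R z" using P0[of b] that D c by (intro mult_left_mono) auto
    then show ?thesis using zR by simp
  qed
  have t3: "c * ((norm \<pi>)\<^sup>2 + (norm \<mu>)\<^sup>2) \<le> 96 * \<theta>"
  proof -
    have "c * (norm \<pi>)\<^sup>2 \<le> 16 * \<theta> + 32 * \<theta>" by (rule cn[OF cb[of \<rho>]]) (use Qsum nn in \<open>simp_all add: x_def\<close>)
    moreover have "c * (norm \<mu>)\<^sup>2 \<le> 16 * \<theta> + 32 * \<theta>"
      by (rule cn[OF cb[of \<gamma>]]) (use Qsum nn in \<open>simp_all add: y_def norm_minus_commute\<close>)
    ultimately show ?thesis by (simp add: algebra_simps)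
  qed
  have t4: "(c + \<alpha> * c * norm x + c\<^sup>2 / 2) + (c + \<alpha> * c * norm y + c\<^sup>2 / 2) \<le> 21 * \<theta>"
  proof -
    have q: "r \<le> 1 + r\<^sup>2" for r :: real using sum_squares_bound[of r 1] by (smt (verit) mult_cancel_left1 one_power2 zero_le_power2)
    have "\<alpha> * c * norm x \<le> \<alpha> * c * (1 + (norm x)\<^sup>2)" "\<alpha> * c * norm y \<le> \<alpha> * c * (1 + (norm y)\<^sup>2)"
      using \<alpha> c by (intro mult_left_mono q; simp)+
    moreover have "c * (\<alpha> * (norm x)\<^sup>2 + \<alpha> * (norm y)\<^sup>2) \<le> 1 * (16 * \<theta>)"
    proof (rule mult_mono)
      show "\<alpha> * (norm x)\<^sup>2 + \<alpha> * (norm y)\<^sup>2 \<le> 16 * \<theta>" using Qsum nn by linarith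
    qed (use c nn in auto)
    moreover have "c\<^sup>2 \<le> c" using c by (simp add: power2_eq_square mult_left_le)
    ultimately show ?thesis using \<alpha>c c\<theta> by (simp add: algebra_simps)
  qed
  have "\<bar>1 - \<kappa>\<bar> * \<alpha> * (norm (\<pi> - \<mu>) * norm w) \<le> 32 * \<bar>1 - \<kappa>\<bar> * \<theta>"
    using mult_left_mono[OF t2, of "\<bar>1 - \<kappa>\<bar>"] by (simp add: algebra_simps)
  moreover have "c * (1 - \<kappa>)\<^sup>2 * ((norm \<pi>)\<^sup>2 + (norm \<mu>)\<^sup>2) \<le> 96 * (1 - \<kappa>)\<^sup>2 * \<theta>"
    using mult_left_mono[OF t3, of "(1 - \<kappa>)\<^sup>2"] by (simp add: algebra_simps)
  ultimately have ham2: "\<alpha> * (G \<rho> - G \<pi>) - \<alpha> * \<kappa> * (\<pi> \<bullet> x) + \<alpha>\<^sup>2 / 2 * (norm x)\<^sup>2 + (c + \<alpha> * c * norm x + c\<^sup>2 / 2)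
       - (\<alpha> * (G \<mu> - G \<gamma>) - \<alpha> * \<kappa> * (\<mu> \<bullet> y) + \<alpha>\<^sup>2 / 2 * (norm y)\<^sup>2 - (c + \<alpha> * c * norm y + c\<^sup>2 / 2))
     \<le> (54 + 32 * \<bar>1 - \<kappa>\<bar> + 96 * (1 - \<kappa>)\<^sup>2) * \<theta>"
    using ham t1 t4 e by (simp add: algebra_simps)
  have "u \<pi> - v \<mu> \<le> h1 \<pi> - h2 \<mu> + l * ((54 + 32 * \<bar>1 - \<kappa>\<bar> + 96 * (1 - \<kappa>)\<^sup>2) * \<theta>) + 2 * \<eta>"
    using \<pi>(3) \<mu>(3) mult_left_mono[OF ham2, of l] l unfolding x_def y_def
    by (simp add: algebra_simps)
  moreover have "h1 \<pi> - h2 \<mu> \<le> S + \<tau> / 2"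
  proof -
    have "(norm (\<pi> - \<mu>))\<^sup>2 \<le> (norm x + norm w + norm y)\<^sup>2"
      unfolding x_def w_def y_def
      by (rule power_mono) (smt (verit) norm_triangle_ineq diff_add_eq add_diff_eq diff_add_cancel, simp)
    also have "\<dots> \<le> 3 * ((norm x)\<^sup>2 + (norm w)\<^sup>2 + (norm y)\<^sup>2)"
      using sum_squares_bound[of "norm x" "norm w"] sum_squares_bound[of "norm y" "norm w"]
        sum_squares_bound[of "norm x" "norm y"]
      by (simp add: power2_eq_square algebra_simps)
    also have "\<dots> \<le> \<alpha> * (3 * ((norm x)\<^sup>2 + (norm w)\<^sup>2 + (norm y)\<^sup>2))"
      by (rule \<alpha>_scale) simp
    also have "\<dots> \<le> 48 * \<theta>" using Qsum by (simp add: algebra_simps)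
    also have "\<dots> < \<delta>\<^sup>2" by (rule \<theta>\<delta>)
    finally have "norm (\<pi> - \<mu>) < \<delta>" using \<delta>(1) by (simp add: power2_less_imp_less)
    then show ?thesis using \<delta>(2)[of \<pi> \<mu>] S[of \<mu>] by linarith
  qed
  moreover have "C * \<theta> = l * ((54 + 32 * \<bar>1 - \<kappa>\<bar> + 96 * (1 - \<kappa>)\<^sup>2) * \<theta>) + 5 * \<theta>"
    unfolding C_def by (simp add: algebra_simps)
  ultimately show "u x0 - v x0 \<le> S + \<tau>"
    using zA \<theta>C \<eta>(2) \<theta>(1) by linarith
qed

section \<open>Smooth bump functions\<close>

lemma continuously_differentiable_SucI:
  assumes "\<And>x. (f has_derivative f' x) (at x)"
    and "\<And>b. b \<in> Basis \<Longrightarrow> continuously_differentiable k (\<lambda>x. f' x b)"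
  shows "continuously_differentiable (Suc k) f"
proof -
  have "frechet_derivative f (at x) = f' x" for x
    using frechet_derivative_at[OF assms(1)] by simp
  then show ?thesis using assms by (auto simp: differentiable_def)
qed

lemma continuously_differentiable_SucD:
  "continuously_differentiable (Suc k) f \<Longrightarrow> continuously_differentiable k f"
proof (induction k arbitrary: f)
  case 0
  then show ?case
    by (auto intro!: differentiable_imp_continuous_on simp: differentiable_on_def differentiable_at_withinI)
next
  case (Suc k)
  then show ?case by (metis continuously_differentiable.simps(2))
qed

lemma continuously_differentiable_const: "continuously_differentiable k (\<lambda>x. c)"
proof (induction k arbitrary: c)
  case (Suc k)
  show ?case by (rule continuously_differentiable_SucI[where f' = "\<lambda>_ _. 0"]) (auto intro: Suc.IH)
qed simp

lemma continuously_differentiable_add: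
  "continuously_differentiable k f \<Longrightarrow> continuously_differentiable k g \<Longrightarrow>
   continuously_differentiable k (\<lambda>x. f x + g x)"
proof (induction k arbitrary: f g)
  case (Suc k)
  show ?case
  proof (rule continuously_differentiable_SucI)
    show "((\<lambda>x. f x + g x) has_derivative
        (\<lambda>h. frechet_derivative f (at x) h + frechet_derivative g (at x) h)) (at x)" for x
      using Suc.prems by (auto intro!: has_derivative_add simp: frechet_derivative_works)
  qed (use Suc in auto)
qed (auto intro: continuous_on_add)

lemma continuously_differentiable_mult:
  "continuously_differentiable k f \<Longrightarrow> continuously_differentiable k g \<Longrightarrow>
   continuously_differentiable k (\<lambda>x. f x * g x)"
proof (induction k arbitrary: f g)
  case (Suc k)
  show ?case
  proof (rule continuously_differentiable_SucI)
    show "((\<lambda>x. f x * g x) has_derivative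
        (\<lambda>h. f x * frechet_derivative g (at x) h + frechet_derivative f (at x) h * g x)) (at x)" for x
      using Suc.prems by (auto intro!: has_derivative_mult simp: frechet_derivative_works)
    show "continuously_differentiable k
        (\<lambda>x. f x * frechet_derivative g (at x) b + frechet_derivative f (at x) b * g x)"
      if "b \<in> Basis" for b
      using Suc that continuously_differentiable_SucD[OF Suc.prems(1)]
        continuously_differentiable_SucD[OF Suc.prems(2)]
      by (intro continuously_differentiable_add Suc.IH) auto
  qed
qed (auto intro: continuous_on_mult)

lemma continuously_differentiable_prod:
  assumes "finite I" "\<And>i. i \<in> I \<Longrightarrow> continuously_differentiable k (f i)"
  shows "continuously_differentiable k (\<lambda>x. \<Prod>i\<in>I. f i x)"
  using assms
  by (induction I rule: finite_induct)
     (auto intro: continuously_differentiable_const continuously_differentiable_mult)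

text \<open>
  Allowing a polynomial factor in \<open>1 / t\<close> makes the family of functions \<open>p(1/t) exp(-1/t)\<close>, extended by
  zero to \<open>t \<le> 0\<close>, closed under differentiation. Smoothness of the standard cut-off, which is the case
  \<open>p = 1\<close>, then follows by induction on the order of differentiability.
\<close>

definition smooth_cutoff :: "real poly \<Rightarrow> real \<Rightarrow> real" where
  "smooth_cutoff p t = (if t > 0 then poly p (1 / t) * exp (- (1 / t)) else 0)"

lemma tendsto_poly_times_exp_minus: "((\<lambda>s::real. poly p s * exp (- s)) \<longlongrightarrow> 0) at_top"
proof -
  have "((\<lambda>s::real. \<Sum>i\<le>degree p. coeff p i * (s ^ i / exp s)) \<longlongrightarrow> (\<Sum>i\<le>degree p. coeff p i * 0)) at_top"
    by (intro tendsto_intros tendsto_power_div_exp_0)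
  then show ?thesis by (simp add: poly_altdef sum_divide_distrib exp_minus field_simps)
qed

lemma smooth_cutoff_tendsto_0: "(smooth_cutoff p \<longlongrightarrow> 0) (at 0)"
proof (rule filterlim_split_at_real)
  show "(smooth_cutoff p \<longlongrightarrow> 0) (at_left 0)"
    by (rule tendsto_eventually) (auto simp: eventually_at_filter smooth_cutoff_def)
  have "((\<lambda>t. poly p (inverse t) * exp (- inverse t)) \<longlongrightarrow> 0) (at_right (0::real))"
    by (rule filterlim_compose[OF tendsto_poly_times_exp_minus filterlim_inverse_at_top_right])
  then show "(smooth_cutoff p \<longlongrightarrow> 0) (at_right 0)"
    by (rule Lim_transform_eventually) (auto simp: eventually_at_filter smooth_cutoff_def inverse_eq_divide)
qed

lemma smooth_cutoff_deriv:
  "(smooth_cutoff p has_real_derivative smooth_cutoff (monom 1 2 * (p - pderiv p)) t) (at t)"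
proof -
  consider "t > 0" | "t < 0" | "t = 0" by linarith
  then show ?thesis
  proof cases
    case 1
    have "((\<lambda>t. poly p (1 / t) * exp (- (1 / t))) has_real_derivative
        smooth_cutoff (monom 1 2 * (p - pderiv p)) t) (at t)"
      using 1 by (auto intro!: derivative_eq_intros DERIV_chain2[OF poly_DERIV]
          simp: smooth_cutoff_def poly_monom power2_eq_square field_simps)
    then show ?thesis
      by (rule has_field_derivative_transform_within_open[of _ _ _ "{0<..}"])
         (use 1 in \<open>auto simp: smooth_cutoff_def\<close>)
  next
    case 2
    have "((\<lambda>t. 0) has_real_derivative smooth_cutoff (monom 1 2 * (p - pderiv p)) t) (at t)"
      using 2 by (simp add: smooth_cutoff_def)
    then show ?thesis
      by (rule has_field_derivative_transform_within_open[of _ _ _ "{..<0}"])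
         (use 2 in \<open>auto simp: smooth_cutoff_def\<close>)
  next
    case 3
    \<comment> \<open>At the origin the difference quotient is again a member of the family.\<close>
    have "(\<lambda>h. (smooth_cutoff p (0 + h) - smooth_cutoff p 0) / h) = smooth_cutoff (pCons 0 p)"
      by (rule ext) (auto simp: smooth_cutoff_def)
    then show ?thesis
      using 3 smooth_cutoff_tendsto_0[of "pCons 0 p"] by (simp add: DERIV_def smooth_cutoff_def)
  qed
qed

lemma continuously_differentiable_smooth_cutoff:
  "continuously_differentiable k (\<lambda>x::'a::euclidean_space. smooth_cutoff p (w \<bullet> x + r))"
proof (induction k arbitrary: p)
  case 0
  have "isCont (smooth_cutoff p) t" for t using smooth_cutoff_deriv DERIV_isCont by blast
  then have c: "continuous_on UNIV (smooth_cutoff p)" by (simp add: continuous_on_eq_continuous_at)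
  show ?case
    unfolding continuously_differentiable.simps
    by (rule continuous_on_compose2[OF c]) (auto intro!: continuous_intros)
next
  case (Suc k)
  show ?case
  proof (rule continuously_differentiable_SucI)
    show "((\<lambda>x. smooth_cutoff p (w \<bullet> x + r)) has_derivative
        (\<lambda>h. smooth_cutoff (monom 1 2 * (p - pderiv p)) (w \<bullet> x + r) * (w \<bullet> h))) (at x)" for x
    proof -
      have "((\<lambda>x. w \<bullet> x + r) has_derivative (\<lambda>h. w \<bullet> h)) (at x)"
        by (auto intro!: derivative_eq_intros)
      from DERIV_compose_FDERIV[OF smooth_cutoff_deriv this] show ?thesis by (simp add: mult.commute)
    qed
    show "continuously_differentiable k
        (\<lambda>x. smooth_cutoff (monom 1 2 * (p - pderiv p)) (w \<bullet> x + r) * (w \<bullet> b))" for b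
      by (intro continuously_differentiable_mult Suc.IH continuously_differentiable_const)
  qed
qed

text \<open>
  Both factors belong to the faces of the box orthogonal to \<open>i\<close>. Since \<open>exp(-1/(n t))\<close> tends to \<open>1\<close> for
  every \<open>t > 0\<close>, stretching the cut-offs turns the product into the indicator of the open box. The
  arguments are spelled as affine functions of \<open>x\<close> so that \<open>continuously_differentiable_smooth_cutoff\<close>
  applies to them.
\<close>

definition box_bump :: "nat \<Rightarrow> 'a \<Rightarrow> 'a \<Rightarrow> 'a::euclidean_space \<Rightarrow> real" where
  "box_bump n a b x =
     (\<Prod>i\<in>Basis. smooth_cutoff 1 ((real (Suc n) *\<^sub>R i) \<bullet> x + - real (Suc n) * (a \<bullet> i))
             * smooth_cutoff 1 ((- real (Suc n) *\<^sub>R i) \<bullet> x + real (Suc n) * (b \<bullet> i)))"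

lemma smooth_cutoff_1_bounds: "0 \<le> smooth_cutoff 1 t" "smooth_cutoff 1 t \<le> 1"
  by (auto simp: smooth_cutoff_def)

lemma box_bump_bounds: "0 \<le> box_bump n a b x" "box_bump n a b x \<le> 1"
  unfolding box_bump_def
  by (auto intro!: prod_nonneg prod_le_1 mult_le_one smooth_cutoff_1_bounds mult_nonneg_nonneg)

lemma box_bump_alt:
  "box_bump n a b x = (\<Prod>i\<in>Basis. smooth_cutoff 1 (real (Suc n) * (x \<bullet> i - a \<bullet> i))
             * smooth_cutoff 1 (real (Suc n) * (b \<bullet> i - x \<bullet> i)))"
  unfolding box_bump_def by (simp add: algebra_simps inner_commute)

lemma box_bump_outside: "x \<notin> box a b \<Longrightarrow> box_bump n a b x = 0"
proof -
  assume "x \<notin> box a b"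
  then obtain i where i: "i \<in> Basis" "x \<bullet> i \<le> a \<bullet> i \<or> b \<bullet> i \<le> x \<bullet> i" by (auto simp: mem_box not_less)
  from i(2) have "smooth_cutoff 1 (real (Suc n) * (x \<bullet> i - a \<bullet> i))
       * smooth_cutoff 1 (real (Suc n) * (b \<bullet> i - x \<bullet> i)) = 0"
    by (auto simp: smooth_cutoff_def zero_less_mult_iff)
  then show ?thesis unfolding box_bump_alt using i(1) by (intro prod_zero) auto
qed

lemma smooth_cutoff_1_limit:
  assumes "t > 0" shows "(\<lambda>n. smooth_cutoff 1 (real (Suc n) * t)) \<longlonglongrightarrow> 1"
proof -
  have "(\<lambda>n. exp (- (inverse (real (Suc n)) * (1 / t)))) \<longlonglongrightarrow> exp (- (0 * (1 / t)))"
    by (intro tendsto_intros LIMSEQ_inverse_real_of_nat)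
  moreover have "smooth_cutoff 1 (real (Suc n) * t) = exp (- (inverse (real (Suc n)) * (1 / t)))" for n
    using assms by (simp add: smooth_cutoff_def field_simps del: of_nat_Suc)
  ultimately show ?thesis by simp
qed

lemma box_bump_limit: "(\<lambda>n. box_bump n a b x) \<longlonglongrightarrow> indicator (box a b) x"
proof (cases "x \<in> box a b")
  case False
  then show ?thesis by (simp add: box_bump_outside)
next
  case True
  have "(\<lambda>n. \<Prod>i\<in>Basis. smooth_cutoff 1 (real (Suc n) * (x \<bullet> i - a \<bullet> i))
             * smooth_cutoff 1 (real (Suc n) * (b \<bullet> i - x \<bullet> i))) \<longlonglongrightarrow> (\<Prod>i\<in>(Basis::'a set). 1 * 1)"
    using True by (intro tendsto_intros smooth_cutoff_1_limit) (auto simp: mem_box)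
  then show ?thesis using True by (simp add: box_bump_alt)
qed

lemma test_function_box_bump: "test_function (box_bump n a b)"
proof -
  have "continuously_differentiable k (box_bump n a b)" for k
    unfolding box_bump_def[abs_def]
    by (intro continuously_differentiable_prod continuously_differentiable_mult
        continuously_differentiable_smooth_cutoff) auto
  moreover have "bounded {x. box_bump n a b x \<noteq> 0}"
    by (rule bounded_subset[OF bounded_box[of a b]]) (use box_bump_outside in blast)
  ultimately show ?thesis by (simp add: test_function_def compact_closure)
qed

lemma test_function_add:
  assumes "test_function f" "test_function g" shows "test_function (\<lambda>x. f x + g x)"
proof -
  have "bounded ({x. f x \<noteq> 0} \<union> {x. g x \<noteq> 0})"
    using assms by (auto simp: test_function_def compact_closure)
  then have "bounded {x. f x + g x \<noteq> 0}" by (rule bounded_subset) auto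
  then show ?thesis
    using assms by (auto simp: test_function_def compact_closure continuously_differentiable_add)
qed

lemma test_function_mult:
  assumes "test_function f" "\<And>k. continuously_differentiable k g" shows "test_function (\<lambda>x. f x * g x)"
proof -
  have "bounded {x. f x \<noteq> 0}"
    using assms by (auto simp: test_function_def compact_closure)
  then have "bounded {x. f x * g x \<noteq> 0}" by (rule bounded_subset) auto
  then show ?thesis
    using assms by (auto simp: test_function_def compact_closure continuously_differentiable_mult)
qed

lemma test_function_scale: "test_function f \<Longrightarrow> test_function (\<lambda>x. c * f x)"
  using test_function_mult[OF _ continuously_differentiable_const, of f c] by (simp add: mult.commute)

lemma test_function_zero: "test_function (\<lambda>x. 0)"
  by (simp add: test_function_def continuously_differentiable_const)

lemma test_function_has_derivative:
  "test_function f \<Longrightarrow> (f has_derivative frechet_derivative f (at x)) (at x)"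
  unfolding test_function_def
  by (metis continuously_differentiable.simps(2) frechet_derivative_works)

lemma test_function_partial:
  assumes f: "test_function f" and b: "b \<in> Basis"
  shows "test_function (\<lambda>x. frechet_derivative f (at x) b)"
proof -
  let ?S = "closure {x. f x \<noteq> 0}"
  have "frechet_derivative f (at x) b = 0" if "x \<notin> ?S" for x
  proof -
    have "((\<lambda>x. 0) has_derivative (\<lambda>_. 0)) (at x)" by simp
    then have "(f has_derivative (\<lambda>_. 0)) (at x)"
    proof (rule has_derivative_transform_within_open[where s = "- ?S"])
      show "0 = f y" if "y \<in> - ?S" for y using that closure_subset[of "{x. f x \<noteq> 0}"] by auto
    qed (use that in auto)
    then show ?thesis using frechet_derivative_at by metis
  qed
  then have "{x. frechet_derivative f (at x) b \<noteq> 0} \<subseteq> ?S" by blast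
  moreover have "bounded ?S" using f by (simp add: test_function_def compact_imp_bounded)
  ultimately have "bounded {x. frechet_derivative f (at x) b \<noteq> 0}" using bounded_subset by blast
  moreover have "continuously_differentiable k (\<lambda>x. frechet_derivative f (at x) b)" for k
    using f b unfolding test_function_def by (metis continuously_differentiable.simps(2))
  ultimately show ?thesis by (simp add: test_function_def compact_closure)
qed

lemma test_function_continuous: "test_function f \<Longrightarrow> continuous_on UNIV f"
  unfolding test_function_def by (metis continuously_differentiable.simps(1))

lemma test_function_bounded_support: "test_function f \<Longrightarrow> bounded {x. f x \<noteq> 0}"
  by (simp add: test_function_def compact_closure)

section \<open>Density of test functions in $L^2$\<close>

lemma square_integrable_rep: "square_integrable (rep_l2 \<rho>)"
  using Quotient3_rep_reflp[OF Quotient3_l2, of \<rho>] by (simp add: l2_rel_def)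

lemma abs_rep_l2: "abs_l2 (rep_l2 \<rho>) = \<rho>"
  by (rule Quotient3_abs_rep[OF Quotient3_l2])

lemma rep_abs_l2: "square_integrable f \<Longrightarrow> AE x in lborel. rep_l2 (abs_l2 f) x = f x"
  using Quotient3_rep_abs[OF Quotient3_l2, of f] by (simp add: l2_rel_def)

lemma rep_l2_measurable[measurable]: "rep_l2 \<rho> \<in> borel_measurable borel"
  using square_integrable_rep[of \<rho>] by (simp add: square_integrable_def)

lemma abs_l2_add:
  "square_integrable f \<Longrightarrow> square_integrable g \<Longrightarrow> abs_l2 (\<lambda>x. f x + g x) = abs_l2 f + abs_l2 g"
  by (rule plus_l2.abs_eq[symmetric]) (auto simp: l2_rel_def eq_onp_def)

lemma abs_l2_diff:
  "square_integrable f \<Longrightarrow> square_integrable g \<Longrightarrow> abs_l2 (\<lambda>x. f x - g x) = abs_l2 f - abs_l2 g"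
  by (rule minus_l2.abs_eq[symmetric]) (auto simp: l2_rel_def eq_onp_def)

lemma abs_l2_scale:
  "square_integrable f \<Longrightarrow> abs_l2 (\<lambda>x. c * f x) = c *\<^sub>R abs_l2 f"
  by (rule scaleR_l2.abs_eq[symmetric]) (auto simp: l2_rel_def eq_onp_def)

lemma inner_abs_l2:
  "square_integrable f \<Longrightarrow> square_integrable g \<Longrightarrow> abs_l2 f \<bullet> abs_l2 g = (LINT x|lborel. f x * g x)"
  by (rule inner_l2.abs_eq) (auto simp: l2_rel_def eq_onp_def)

lemma rep_l2_add: "AE x in lborel. rep_l2 (\<rho> + \<sigma>) x = rep_l2 \<rho> x + rep_l2 \<sigma> x"
  using rep_abs_l2[OF square_integrable_add[OF square_integrable_rep square_integrable_rep], of \<rho> \<sigma>]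
  by (simp add: abs_l2_add square_integrable_rep abs_rep_l2)

lemma rep_l2_scale: "AE x in lborel. rep_l2 (c *\<^sub>R \<rho>) x = c * rep_l2 \<rho> x"
  using rep_abs_l2[OF square_integrable_scale[OF square_integrable_rep], of c \<rho>]
  by (simp add: abs_l2_scale square_integrable_rep abs_rep_l2)

lemma norm_abs_l2: "square_integrable f \<Longrightarrow> (norm (abs_l2 f))\<^sup>2 = (LINT x|lborel. (f x)\<^sup>2)"
  unfolding power2_norm_eq_inner by (simp add: inner_abs_l2 power2_eq_square)

lemma square_integrable_dominated:
  assumes "f \<in> borel_measurable lborel" "square_integrable g" "\<And>x. \<bar>f x\<bar> \<le> \<bar>g x\<bar>"
  shows "square_integrable f"
  unfolding square_integrable_def
proof
  show "integrable lborel (\<lambda>x. (f x)\<^sup>2)"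
    by (rule Bochner_Integration.integrable_bound[of _ "\<lambda>x. (g x)\<^sup>2"])
       (use assms in \<open>auto simp: square_integrable_def abs_le_square_iff[symmetric]\<close>)
qed (rule assms)

lemma abs_l2_dominated_convergence:
  fixes F :: "'a::euclidean_space \<Rightarrow> real"
  assumes f: "\<And>n. f n \<in> borel_measurable lborel" and F: "F \<in> borel_measurable lborel"
    and g: "square_integrable g" and dom: "\<And>n x. \<bar>f n x\<bar> \<le> \<bar>g x\<bar>"
    and lim: "\<And>x. (\<lambda>n. f n x) \<longlonglongrightarrow> F x"
  shows "(\<lambda>n. abs_l2 (f n)) \<longlonglongrightarrow> abs_l2 F"
proof -
  have domF: "\<bar>F x\<bar> \<le> \<bar>g x\<bar>" for x
    by (rule Lim_bounded[OF tendsto_rabs[OF lim[of x]]]) (use dom in auto)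
  have sf: "square_integrable (f n)" for n by (rule square_integrable_dominated[OF f g dom])
  have sF: "square_integrable F" by (rule square_integrable_dominated[OF F g domF])
  have "(\<lambda>n. LINT x|lborel. (f n x - F x)\<^sup>2) \<longlonglongrightarrow> (LINT x|(lborel :: 'a measure). 0 :: real)"
  proof (rule integral_dominated_convergence[where w = "\<lambda>x. 4 * (g x)\<^sup>2"])
    have "(\<lambda>n. (f n x - F x)\<^sup>2) \<longlonglongrightarrow> (F x - F x)\<^sup>2" for x
      by (intro tendsto_intros lim)
    then show "AE x in lborel. (\<lambda>n. (f n x - F x)\<^sup>2) \<longlonglongrightarrow> 0" by simp
    show "AE x in lborel. norm ((f n x - F x)\<^sup>2) \<le> 4 * (g x)\<^sup>2" for n
    proof (intro AE_I2)
      fix x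
      have "\<bar>f n x - F x\<bar> \<le> \<bar>2 * g x\<bar>" using dom[of n x] domF[of x] by linarith
      then have "(f n x - F x)\<^sup>2 \<le> (2 * g x)\<^sup>2" by (simp only: abs_le_square_iff)
      then show "norm ((f n x - F x)\<^sup>2) \<le> 4 * (g x)\<^sup>2" by (simp add: power_mult_distrib)
    qed
  qed (use f F g in \<open>auto simp: square_integrable_def\<close>)
  then have "(\<lambda>n. (norm (abs_l2 (f n) - abs_l2 F))\<^sup>2) \<longlonglongrightarrow> 0"
    by (simp add: abs_l2_diff[symmetric] norm_abs_l2 square_integrable_diff sf sF)
  then have "(\<lambda>n. norm (abs_l2 (f n) - abs_l2 F)) \<longlonglongrightarrow> 0"
    using tendsto_real_sqrt by fastforce
  then show ?thesis by (simp add: tendsto_norm_zero_iff LIM_zero_cancel)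
qed

lemma integrable_indicator_box: "integrable lborel (indicat_real (box a b))"
proof -
  have "emeasure lborel (box a b) \<le> emeasure lborel (cbox a b)"
    by (intro emeasure_mono box_subset_cbox) auto
  also have "\<dots> < \<infinity>" by (rule emeasure_lborel_cbox_finite)
  finally show ?thesis by (intro integrable_real_indicator) auto
qed

lemma square_integrable_indicator_box: "square_integrable (indicator (box a b))"
  unfolding square_integrable_def
proof
  have "(indicator (box a b) x :: real)\<^sup>2 = indicator (box a b) x" for x :: 'a by (simp add: indicator_def)
  then show "integrable lborel (\<lambda>x. (indicator (box a b) x :: real)\<^sup>2)"
    using integrable_indicator_box[of a b] by simp
qed simp

lemma square_integrable_bounded_support:
  fixes f :: "'a::euclidean_space \<Rightarrow> real"
  assumes f: "continuous_on UNIV f" and b: "bounded {x. f x \<noteq> 0}"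
  shows "square_integrable f" "integrable lborel f"
proof -
  from bounded_subset_box_symmetric[OF b] obtain a where a: "{x. f x \<noteq> 0} \<subseteq> box (-a) a" by auto
  have "compact (f ` cbox (-a) a)"
    by (intro compact_continuous_image continuous_on_subset[OF f]) auto
  then obtain K where K: "\<And>x. x \<in> cbox (-a) a \<Longrightarrow> \<bar>f x\<bar> \<le> K"
    using compact_imp_bounded[of "f ` cbox (-a) a"] unfolding bounded_iff image_iff real_norm_def
    by blast
  have m: "f \<in> borel_measurable borel" by (rule borel_measurable_continuous_onI[OF f])
  have le: "\<bar>f x\<bar> \<le> \<bar>K * indicator (box (-a) a) x\<bar>" for x
    using a K[of x] box_subset_cbox[of "-a" a] by (cases "f x = 0") (auto simp: indicator_def)
  show "square_integrable f"
    by (rule square_integrable_dominated[OF _ square_integrable_scale[OF square_integrable_indicator_box] le])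
       (use m in simp)
  show "integrable lborel f"
    by (rule Bochner_Integration.integrable_bound[of _ "\<lambda>x. K * indicator (box (-a) a) x"])
       (use m le in \<open>auto intro!: integrable_mult_right integrable_indicator_box\<close>)
qed

lemma test_function_square_integrable: "test_function f \<Longrightarrow> square_integrable f"
  using square_integrable_bounded_support test_function_continuous test_function_bounded_support by blast

definition l2_test :: "'a::euclidean_space l2 set" where
  "l2_test = abs_l2 ` {f. test_function f}"

lemma subspace_l2_test: "subspace l2_test"
proof (rule subspaceI)
  show "0 \<in> (l2_test :: 'a l2 set)"
    unfolding l2_test_def zero_l2_def using test_function_zero by auto
  show "x + y \<in> l2_test" if "x \<in> l2_test" "y \<in> l2_test" for x y :: "'a l2"
  proof -
    from that obtain f g where "x = abs_l2 f" "y = abs_l2 g" "test_function f" "test_function g"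
      by (auto simp: l2_test_def)
    then show ?thesis
      using test_function_add[of f g] abs_l2_add[of f g] test_function_square_integrable
      by (auto simp: l2_test_def intro!: image_eqI[of _ _ "\<lambda>x. f x + g x"] abs_l2_add[symmetric])
  qed
  show "c *\<^sub>R x \<in> l2_test" if "x \<in> l2_test" for c and x :: "'a l2"
  proof -
    from that obtain f where "x = abs_l2 f" "test_function f" by (auto simp: l2_test_def)
    then show ?thesis
      using test_function_scale[of f c] abs_l2_scale[of f c] test_function_square_integrable
      by (auto simp: l2_test_def intro!: image_eqI[of _ _ "\<lambda>x. c * f x"] abs_l2_scale[symmetric])
  qed
qed

lemma closure_l2_test_add:
  assumes "x \<in> closure l2_test" "y \<in> closure l2_test" shows "x + y \<in> closure l2_test"
proof -
  from assms obtain X Y where "\<And>n. X n \<in> l2_test" "X \<longlonglongrightarrow> x" "\<And>n. Y n \<in> l2_test" "Y \<longlonglongrightarrow> y"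
    unfolding closure_sequential by auto
  then show ?thesis
    unfolding closure_sequential
    by (intro exI[of _ "\<lambda>n. X n + Y n"]) (auto intro: subspace_add[OF subspace_l2_test] tendsto_add)
qed

lemma closure_l2_test_scale:
  assumes "x \<in> closure l2_test" shows "c *\<^sub>R x \<in> closure l2_test"
proof -
  from assms obtain X where "\<And>n. X n \<in> l2_test" "X \<longlonglongrightarrow> x"
    unfolding closure_sequential by auto
  then show ?thesis
    unfolding closure_sequential
    by (intro exI[of _ "\<lambda>n. c *\<^sub>R X n"])
       (auto intro: subspace_scale[OF subspace_l2_test] tendsto_scaleR)
qed

lemma zero_in_closure_l2_test: "abs_l2 (\<lambda>x. 0) \<in> closure l2_test"
  using subspace_0[OF subspace_l2_test] closure_subset unfolding zero_l2_def by blast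

lemma closure_l2_test_diff: "x \<in> closure l2_test \<Longrightarrow> y \<in> closure l2_test \<Longrightarrow> x - y \<in> closure l2_test"
  using closure_l2_test_add[OF _ closure_l2_test_scale[of y "-1"], of x] by simp

lemma closure_l2_test_dominated:
  assumes "\<And>n. f n \<in> borel_measurable lborel" "F \<in> borel_measurable lborel" "square_integrable g"
    "\<And>n x. \<bar>f n x\<bar> \<le> \<bar>g x\<bar>" "\<And>x. (\<lambda>n. f n x) \<longlonglongrightarrow> F x" "\<And>n. abs_l2 (f n) \<in> closure l2_test"
  shows "abs_l2 F \<in> closure l2_test"
  using closed_sequentially[OF closed_closure _ abs_l2_dominated_convergence[OF assms(1-5)]] assms(6)
  by blast

lemma indicator_box_in_closure: "abs_l2 (indicator (box a b)) \<in> closure l2_test"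
proof (rule closure_l2_test_dominated[OF _ _ square_integrable_indicator_box[of a b], of "\<lambda>n. box_bump n a b"])
  show "box_bump n a b \<in> borel_measurable lborel" for n
    using test_function_square_integrable[OF test_function_box_bump, of n a b] by (simp add: square_integrable_def)
  show "\<bar>box_bump n a b x\<bar> \<le> \<bar>indicator (box a b) x\<bar>" for n x
    using box_bump_bounds[of n a b x] box_bump_outside[of x a b n] by (auto simp: indicator_def)
  show "abs_l2 (box_bump n a b) \<in> closure l2_test" for n
    using test_function_box_bump closure_subset by (fastforce simp: l2_test_def)
qed (auto intro: box_bump_limit)

lemma square_integrable_indicator_in_box:
  "A \<in> sets borel \<Longrightarrow> square_integrable (indicator (A \<inter> box c d))"
  by (rule square_integrable_dominated[OF _ square_integrable_indicator_box[of c d]]) (auto simp: indicator_def)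

text \<open>
  Open boxes form an intersection-stable generator of the Borel sets, so Dynkin's theorem extends
  \<open>indicator_box_in_closure\<close> from boxes to Borel sets. The fixed box keeps all indicators square
  integrable, in particular that of a complement.
\<close>

lemma indicator_in_box_in_closure:
  assumes "A \<in> sets borel"
  shows "abs_l2 (indicator (A \<inter> box c d)) \<in> closure l2_test"
proof -
  have stable: "Int_stable (range (\<lambda>(a, b). box a b :: 'a set))"
  proof (rule Int_stableI)
    fix A B assume "A \<in> range (\<lambda>(a, b). box a b :: 'a set)" "B \<in> range (\<lambda>(a, b). box a b :: 'a set)"
    then obtain a b c d where "A = box a b" "B = box c d" by auto
    then show "A \<inter> B \<in> range (\<lambda>(a, b). box a b)"
      by (auto simp: box_Int_box intro!: range_eqI[of _ _ "(_, _)"])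
  qed
  have sub: "range (\<lambda>(a, b). box a b :: 'a set) \<subseteq> Pow UNIV" by simp
  have "A \<in> sigma_sets UNIV (range (\<lambda>(a, b). box a b))" using assms by (simp add: borel_eq_box)
  from stable sub this show ?thesis
  proof (induction rule: sigma_sets_induct_disjoint)
    case (basic A)
    then obtain a b where "A = box a b" by auto
    then show ?case by (simp add: box_Int_box indicator_box_in_closure)
  next
    case empty
    show ?case using zero_in_closure_l2_test by simp
  next
    case (compl A)
    note A = compl.hyps and IH = compl.IH
    from A have A: "A \<in> sets borel" by (simp add: borel_eq_box)
    have "(indicator ((UNIV - A) \<inter> box c d) :: 'a \<Rightarrow> real) =
        (\<lambda>x. indicator (box c d) x - indicator (A \<inter> box c d) x)"
      by (auto simp: indicator_def)
    then show ?case
      using closure_l2_test_diff[OF indicator_box_in_closure IH]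
        abs_l2_diff[OF square_integrable_indicator_box square_integrable_indicator_in_box[OF A]]
      by simp
  next
    case (union A)
    note disj = union.hyps(1) and A = union.hyps(2) and IH = union.IH
    from A have A: "A i \<in> sets borel" for i by (auto simp: borel_eq_box)
    have fin: "abs_l2 (indicator ((\<Union>i<n. A i) \<inter> box c d)) \<in> closure l2_test" for n
    proof (induction n)
      case 0
      show ?case using zero_in_closure_l2_test by simp
    next
      case (Suc n)
      have "A n \<inter> A i = {}" if "i < n" for i using disj that by (auto simp: disjoint_family_on_def)
      then have "((\<Union>i<n. A i) \<inter> box c d) \<inter> (A n \<inter> box c d) = {}" by blast
      moreover have "(\<Union>i<Suc n. A i) \<inter> box c d = (\<Union>i<n. A i) \<inter> box c d \<union> A n \<inter> box c d"
        by (auto simp: lessThan_Suc)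
      ultimately have "(indicator ((\<Union>i<Suc n. A i) \<inter> box c d) :: 'a \<Rightarrow> real) =
          (\<lambda>x. indicator ((\<Union>i<n. A i) \<inter> box c d) x + indicator (A n \<inter> box c d) x)"
        by (simp add: indicator_add)
      then show ?case
        using closure_l2_test_add[OF Suc.IH IH[of n]]
          abs_l2_add[OF square_integrable_indicator_in_box square_integrable_indicator_in_box, of "\<Union>i<n. A i" "A n" c d c d] A
        by simp
    qed
    show ?case
    proof (rule closure_l2_test_dominated[OF _ _ square_integrable_indicator_box[of c d] _ _ fin])
      show "(\<lambda>n. indicator ((\<Union>i<n. A i) \<inter> box c d) x :: real) \<longlonglongrightarrow> indicator (\<Union>(range A) \<inter> box c d) x" for x
      proof (cases "x \<in> \<Union>(range A)")
        case True
        then obtain k where k: "x \<in> A k" by auto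
        have "\<forall>\<^sub>F n in sequentially. x \<in> (\<Union>i<n. A i)"
          using eventually_gt_at_top[of k] by eventually_elim (use k in auto)
        then show ?thesis
          by (intro tendsto_eventually) (auto elim!: eventually_mono simp: indicator_def)
      qed (auto simp: indicator_def)
    qed (use A in \<open>auto simp: indicator_def intro!: borel_measurable_indicator\<close>)
  qed
qed

lemma bounded_boxes_exhaust:
  fixes x :: "'a::euclidean_space"
  shows "\<forall>\<^sub>F n in sequentially. x \<in> box (- (real n *\<^sub>R One)) (real n *\<^sub>R One)"
proof -
  obtain k :: nat where k: "norm x < k" using reals_Archimedean2 by blast
  have "x \<in> box (- (real n *\<^sub>R One)) (real n *\<^sub>R One)" if "k \<le> n" for n
  proof -
    have "\<bar>x \<bullet> i\<bar> < real n" if "i \<in> Basis" for i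
      using Basis_le_norm[OF that, of x] k \<open>k \<le> n\<close> by linarith
    then show ?thesis by (fastforce simp: mem_box abs_less_iff)
  qed
  then show ?thesis by (auto simp: eventually_sequentially)
qed

text \<open>
  The usual induction over non-negative measurable functions. Square integrability is part of the
  induction predicate: it passes to the summands and to the members of an increasing sequence because
  these are dominated by the function that they build up.
\<close>

lemma abs_l2_nonneg_in_closure:
  fixes f :: "'a::euclidean_space \<Rightarrow> real"
  assumes "f \<in> borel_measurable lborel" "\<And>x. 0 \<le> f x"
  shows "square_integrable f \<longrightarrow> abs_l2 f \<in> closure l2_test"
  using assms
proof (induction rule: borel_measurable_induct_real)
  case (set A)
  then have A: "A \<in> sets borel" by simp
  show ?case
  proof
    assume sq: "square_integrable (indicat_real A)"
    show "abs_l2 (indicat_real A) \<in> closure l2_test"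
    proof (rule closure_l2_test_dominated[OF _ _ sq _ _ indicator_in_box_in_closure[OF A]])
      show "(\<lambda>n. indicat_real (A \<inter> box (- (real n *\<^sub>R One)) (real n *\<^sub>R One)) x) \<longlonglongrightarrow> indicat_real A x" for x
        by (intro tendsto_eventually eventually_mono[OF bounded_boxes_exhaust[of x]]) (auto simp: indicator_def)
    qed (use A in \<open>auto simp: indicator_def\<close>)
  qed
next
  case (mult u c)
  show ?case
  proof
    assume sq: "square_integrable (\<lambda>x. c * u x)"
    show "abs_l2 (\<lambda>x. c * u x) \<in> closure l2_test"
    proof (cases "c = 0")
      case True
      then show ?thesis using zero_in_closure_l2_test by simp
    next
      case False
      then have "square_integrable u"
        using square_integrable_scale[OF sq, of "1 / c"] by simp
      then show ?thesis using mult.IH abs_l2_scale[of u c] closure_l2_test_scale by simp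
    qed
  qed
next
  case (add u v)
  show ?case
  proof
    assume sq: "square_integrable (\<lambda>x. v x + u x)"
    have "square_integrable u" "square_integrable v"
      by (rule square_integrable_dominated[OF _ sq]; use add in \<open>auto simp: add_nonneg_nonneg\<close>)+
    then show "abs_l2 (\<lambda>x. v x + u x) \<in> closure l2_test"
      using add.IH abs_l2_add[of v u] closure_l2_test_add by simp
  qed
next
  case (seq U)
  show ?case
  proof
    assume sq: "square_integrable f"
    have le: "U n x \<le> f x" for n x
    proof (rule incseq_le)
      show "incseq (\<lambda>n. U n x)" using seq.hyps(3) by (simp add: incseq_def le_fun_def)
      show "(\<lambda>n. U n x) \<longlonglongrightarrow> f x" by (rule seq.hyps(4)) simp
    qed
    have dom: "\<bar>U n x\<bar> \<le> \<bar>f x\<bar>" for n x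
      using le[of n x] seq.hyps(2)[of n x] by simp
    have sqU: "square_integrable (U n)" for n
      by (rule square_integrable_dominated[OF _ sq dom]) (use seq(1) in simp)
    show "abs_l2 f \<in> closure l2_test"
    proof (rule closure_l2_test_dominated[OF _ _ sq dom])
      show "U n \<in> borel_measurable lborel" for n by (rule seq(1))
      show "f \<in> borel_measurable lborel" by (rule assms(1))
      show "(\<lambda>n. U n x) \<longlonglongrightarrow> f x" for x by (rule seq.hyps(4)) simp
      show "abs_l2 (U n) \<in> closure l2_test" for n using seq.IH[of n] sqU by simp
    qed
  qed
qed

lemma closure_l2_test: "closure l2_test = (UNIV :: 'a::euclidean_space l2 set)"
proof -
  have "\<rho> \<in> closure l2_test" for \<rho> :: "'a l2"
  proof -
    let ?p = "\<lambda>x. max 0 (rep_l2 \<rho> x)" and ?m = "\<lambda>x. max 0 (- rep_l2 \<rho> x)"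
    have p: "square_integrable ?p" and m: "square_integrable ?m"
      by (rule square_integrable_dominated[OF _ square_integrable_rep[of \<rho>]]; simp)+
    have "\<rho> = abs_l2 (\<lambda>x. ?p x - ?m x)"
      by (subst abs_rep_l2[symmetric]) (rule arg_cong[where f = abs_l2], auto)
    also have "\<dots> = abs_l2 ?p - abs_l2 ?m" using p m by (rule abs_l2_diff)
    finally show ?thesis
      using p m abs_l2_nonneg_in_closure[of ?p] abs_l2_nonneg_in_closure[of ?m]
        closure_l2_test_diff[of "abs_l2 ?p" "abs_l2 ?m"]
      by (auto simp: square_integrable_def)
  qed
  then show ?thesis by auto
qed

section \<open>Weak derivatives and convexity of the energy\<close>

lemma integral_lborel_translate:
  fixes f :: "'a::euclidean_space \<Rightarrow> real"
  assumes "f \<in> borel_measurable borel"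
  shows "(LINT x|lborel. f (x + h)) = (LINT x|lborel. f x)"
proof -
  have "(LINT x|lborel. f x) = (LINT x|distr lborel borel ((+) h). f x)" by (simp add: lborel_distr_plus)
  also have "\<dots> = (LINT x|lborel. f (h + x))" by (rule integral_distr) (use assms in auto)
  finally show ?thesis by (simp add: add.commute)
qed

lemma integrable_lborel_translate:
  fixes f :: "'a::euclidean_space \<Rightarrow> real"
  assumes "integrable lborel f"
  shows "integrable lborel (\<lambda>x. f (x + h))"
proof -
  have "integrable (distr lborel borel ((+) h)) f" using assms by (simp add: lborel_distr_plus)
  then show ?thesis using assms by (subst (asm) integrable_distr_eq) (auto simp: add.commute)
qed

text \<open>
  Difference quotients in the direction \<open>b\<close> have integral zero by translation invariance. By the mean
  value theorem each of them is a value of the continuous, compactly supported derivative at a distance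
  of at most \<open>1\<close>, which gives a dominating function for the passage to the limit.
\<close>

lemma integral_test_function_partial:
  fixes f :: "'a::euclidean_space \<Rightarrow> real"
  assumes f: "test_function f" and b: "b \<in> Basis"
  shows "(LINT x|lborel. frechet_derivative f (at x) b) = 0"
proof -
  define D where "D x = frechet_derivative f (at x) b" for x
  have D: "test_function D" unfolding D_def using f b by (rule test_function_partial)
  have fm: "f \<in> borel_measurable borel" and Dm: "D \<in> borel_measurable borel"
    using f D by (auto intro!: borel_measurable_continuous_onI test_function_continuous)
  have fint: "integrable lborel f"
    using square_integrable_bounded_support(2) test_function_continuous[OF f] test_function_bounded_support[OF f] .
  obtain R where R: "0 < R" "\<And>x. D x \<noteq> 0 \<Longrightarrow> norm x \<le> R"
    using test_function_bounded_support[OF D] unfolding bounded_pos by auto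
  have "compact (D ` cball 0 R)"
    by (intro compact_continuous_image continuous_on_subset[OF test_function_continuous[OF D]]) auto
  then obtain K where K: "\<And>x. x \<in> cball 0 R \<Longrightarrow> \<bar>D x\<bar> \<le> K"
    using compact_imp_bounded[of "D ` cball 0 R"] unfolding bounded_iff image_iff real_norm_def by blast
  have deriv: "((\<lambda>t. f (x + t *\<^sub>R b)) has_real_derivative D (x + t *\<^sub>R b)) (at t)" for x t
  proof -
    have "((\<lambda>t. x + t *\<^sub>R b) has_derivative (\<lambda>h. h *\<^sub>R b)) (at t)"
      by (auto intro!: derivative_eq_intros)
    from has_derivative_compose[OF this test_function_has_derivative[OF f]]
    have "((\<lambda>t. f (x + t *\<^sub>R b)) has_derivative (\<lambda>h. frechet_derivative f (at (x + t *\<^sub>R b)) (h *\<^sub>R b))) (at t)" .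
    moreover have "frechet_derivative f (at y) (h *\<^sub>R b) = D y * h" for y h
      using linear_scale[OF has_derivative_linear[OF test_function_has_derivative[OF f, of y]], of h b]
      by (simp add: D_def mult.commute)
    ultimately show ?thesis by (simp add: has_field_derivative_def)
  qed
  define h :: "nat \<Rightarrow> real" where "h n = inverse (real (Suc n))" for n
  have h: "0 < h n" "h n \<le> 1" for n by (auto simp: h_def field_simps)
  define q where "q n x = (f (x + h n *\<^sub>R b) - f x) / h n" for n x
  have q_D: "\<exists>z. 0 < z \<and> z < 1 \<and> q n x = D (x + z *\<^sub>R b)" for n x
  proof -
    have "\<exists>z. 0 < z \<and> z < h n \<and> f (x + h n *\<^sub>R b) - f (x + 0 *\<^sub>R b) = (h n - 0) * D (x + z *\<^sub>R b)"
      by (rule MVT2) (use h deriv in auto)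
    then show ?thesis using h[of n] by (fastforce simp: q_def)
  qed
  have "(\<lambda>n. LINT x|lborel. q n x) \<longlonglongrightarrow> (LINT x|lborel. D x)"
  proof (rule integral_dominated_convergence[where w = "\<lambda>x. K * indicator (cball 0 (R + 1)) x"])
    show "AE x in lborel. (\<lambda>n. q n x) \<longlonglongrightarrow> D x"
    proof (intro AE_I2)
      fix x
      have "((\<lambda>t. (f (x + (0 + t) *\<^sub>R b) - f (x + 0 *\<^sub>R b)) / t) \<longlongrightarrow> D (x + 0 *\<^sub>R b)) (at 0)"
        using deriv[of x 0] by (simp add: DERIV_def)
      moreover have "filterlim h (at 0) sequentially"
        unfolding filterlim_at h_def[abs_def] using LIMSEQ_inverse_real_of_nat by (auto simp: o_def)
      ultimately show "(\<lambda>n. q n x) \<longlonglongrightarrow> D x"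
        using filterlim_compose[of "\<lambda>t. (f (x + (0 + t) *\<^sub>R b) - f (x + 0 *\<^sub>R b)) / t"] by (force simp: q_def)
    qed
    show "AE x in lborel. norm (q n x) \<le> K * indicator (cball 0 (R + 1)) x" for n
    proof (intro AE_I2)
      fix x
      obtain z where z: "0 < z" "z < 1" "q n x = D (x + z *\<^sub>R b)" using q_D by blast
      show "norm (q n x) \<le> K * indicator (cball 0 (R + 1)) x"
      proof (cases "q n x = 0")
        case True
        have "0 \<le> K" using K[of 0] R(1) by simp
        then show ?thesis using True by (auto simp: indicator_def)
      next
        case False
        then have nR: "norm (x + z *\<^sub>R b) \<le> R" using R(2) z by auto
        have "norm x \<le> norm (x + z *\<^sub>R b) + norm (z *\<^sub>R b)"
          by (metis add_diff_cancel_right' norm_triangle_ineq4)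
        also have "\<dots> \<le> R + 1" using nR z b by simp
        finally show ?thesis using K[of "x + z *\<^sub>R b"] nR z by (simp add: indicator_def)
      qed
    qed
  qed (use fm Dm in \<open>auto simp: q_def intro!: integrable_mult_right integrable_real_indicator emeasure_lborel_cball_finite\<close>)
  moreover have "(LINT x|lborel. q n x) = 0" for n
    using fint integrable_lborel_translate[OF fint, of "h n *\<^sub>R b"] integral_lborel_translate[OF fm, of "h n *\<^sub>R b"]
    by (simp add: q_def)
  ultimately show ?thesis by (simp add: D_def LIMSEQ_const_iff)
qed

lemma test_function_integration_by_parts:
  fixes f g :: "'a::euclidean_space \<Rightarrow> real"
  assumes f: "test_function f" and g: "test_function g" and b: "b \<in> Basis"
  shows "(LINT x|lborel. f x * frechet_derivative g (at x) b)
       = - (LINT x|lborel. frechet_derivative f (at x) b * g x)"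
proof -
  have fg: "test_function (\<lambda>x. f x * g x)"
    using test_function_mult[OF f] g by (simp add: test_function_def)
  have "frechet_derivative (\<lambda>x. f x * g x) (at x) b
      = f x * frechet_derivative g (at x) b + frechet_derivative f (at x) b * g x" for x
    using fun_cong[OF frechet_derivative_at[OF has_derivative_mult[OF test_function_has_derivative[OF f]
        test_function_has_derivative[OF g]], of x], of b] by simp
  then have "(LINT x|lborel. f x * frechet_derivative g (at x) b + frechet_derivative f (at x) b * g x) = 0"
    using integral_test_function_partial[OF fg b] by simp
  moreover have "integrable lborel (\<lambda>x. f x * frechet_derivative g (at x) b)"
    "integrable lborel (\<lambda>x. frechet_derivative f (at x) b * g x)"
    using f g b by (auto intro!: square_integrable_mult test_function_square_integrable test_function_partial)
  ultimately show ?thesis by simp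
qed

text \<open>
  Written with the inner product of \<open>L\<^sup>2\<close>, the defining identity is visibly linear in \<open>\<rho>\<close> and \<open>g\<close>, and
  representatives disappear.
\<close>

lemma is_weak_partial_iff_inner:
  assumes b: "b \<in> Basis"
  shows "is_weak_partial b \<rho> g \<longleftrightarrow>
    (\<forall>\<phi>. test_function \<phi> \<longrightarrow> \<rho> \<bullet> abs_l2 (\<lambda>x. frechet_derivative \<phi> (at x) b) = - (g \<bullet> abs_l2 \<phi>))"
proof -
  have i: "\<sigma> \<bullet> abs_l2 \<psi> = (LINT x|lborel. rep_l2 \<sigma> x * \<psi> x)" if "test_function \<psi>" for \<sigma> :: "'a l2" and \<psi>
    using inner_abs_l2[OF square_integrable_rep test_function_square_integrable[OF that], of \<sigma>]
    by (simp add: abs_rep_l2)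
  show ?thesis
    unfolding is_weak_partial_def using i[OF test_function_partial[OF _ b]] i by auto
qed

text \<open>
  The difference of two weak derivatives is orthogonal to all test functions, hence by density to
  itself. This is what gives \<open>weak_partial\<close>, a definite description, its meaning.
\<close>

lemma is_weak_partial_unique:
  assumes b: "b \<in> Basis" and g: "is_weak_partial b \<rho> g" "is_weak_partial b \<rho> g'"
  shows "g = g'"
proof -
  have "(g - g') \<bullet> x = 0" if x: "x \<in> l2_test" for x
  proof -
    from x obtain \<phi> where "x = abs_l2 \<phi>" "test_function \<phi>" by (auto simp: l2_test_def)
    then show ?thesis using g unfolding is_weak_partial_iff_inner[OF b] by (simp add: inner_diff_left)
  qed
  moreover have "g - g' \<in> closure l2_test" by (simp add: closure_l2_test)
  then obtain X where X: "\<And>n. X n \<in> l2_test" "X \<longlonglongrightarrow> g - g'" unfolding closure_sequential by auto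
  ultimately have "(\<lambda>n. 0) \<longlonglongrightarrow> (g - g') \<bullet> (g - g')"
    using tendsto_inner[OF tendsto_const[of "g - g'"] X(2)] by simp
  then have "(g - g') \<bullet> (g - g') = 0" by (simp add: LIMSEQ_const_iff)
  then show ?thesis by simp
qed

lemma is_weak_partial_lincomb:
  assumes "b \<in> Basis" "is_weak_partial b \<rho> g" "is_weak_partial b \<sigma> h"
  shows "is_weak_partial b (s *\<^sub>R \<rho> + t *\<^sub>R \<sigma>) (s *\<^sub>R g + t *\<^sub>R h)"
  using assms by (simp add: is_weak_partial_iff_inner inner_add_left)

lemma weak_partial_eq:
  assumes "b \<in> Basis" "is_weak_partial b \<rho> g" shows "weak_partial b \<rho> = g"
  unfolding weak_partial_def
  by (rule the_equality, rule assms(2)) (rule is_weak_partial_unique[OF assms(1) _ assms(2)])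

lemma is_weak_partial_weak_partial:
  assumes "\<rho> \<in> H1" "b \<in> Basis" shows "is_weak_partial b \<rho> (weak_partial b \<rho>)"
proof -
  obtain g where "is_weak_partial b \<rho> g" using assms by (auto simp: H1_def)
  then show ?thesis using weak_partial_eq[OF assms(2)] by simp
qed

lemma H1_lincomb:
  fixes \<rho> \<sigma> :: "'a::euclidean_space l2"
  assumes "\<rho> \<in> H1" "\<sigma> \<in> H1" shows "s *\<^sub>R \<rho> + t *\<^sub>R \<sigma> \<in> H1"
  unfolding H1_def
proof (intro CollectI ballI)
  fix b :: 'a assume b: "b \<in> Basis"
  obtain g h where "is_weak_partial b \<rho> g" "is_weak_partial b \<sigma> h"
    using assms b unfolding H1_def by blast
  from is_weak_partial_lincomb[OF b this] show "\<exists>g. is_weak_partial b (s *\<^sub>R \<rho> + t *\<^sub>R \<sigma>) g" by blast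
qed

lemma weak_partial_lincomb:
  assumes "\<rho> \<in> H1" "\<sigma> \<in> H1" "b \<in> Basis"
  shows "weak_partial b (s *\<^sub>R \<rho> + t *\<^sub>R \<sigma>) = s *\<^sub>R weak_partial b \<rho> + t *\<^sub>R weak_partial b \<sigma>"
  using assms by (intro weak_partial_eq is_weak_partial_lincomb is_weak_partial_weak_partial)

lemma l2_test_subset_H1: "l2_test \<subseteq> H1"
proof
  fix \<rho> :: "'a l2" assume "\<rho> \<in> l2_test"
  then obtain f where f: "\<rho> = abs_l2 f" "test_function f" by (auto simp: l2_test_def)
  have "is_weak_partial b \<rho> (abs_l2 (\<lambda>x. frechet_derivative f (at x) b))" if b: "b \<in> Basis" for b
    unfolding is_weak_partial_iff_inner[OF b] f(1)
    using f(2) b test_function_integration_by_parts[OF f(2) _ b]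
    by (simp add: inner_abs_l2 test_function_square_integrable test_function_partial)
  then show "\<rho> \<in> H1" unfolding H1_def by blast
qed

definition finite_energy :: "(real \<Rightarrow> real) \<Rightarrow> 'a::euclidean_space l2 set" where
  "finite_energy F = {\<rho> \<in> H1. integrable lborel (\<lambda>x. F (rep_l2 \<rho> x))}"

definition convex_energy :: "(real \<Rightarrow> real) \<Rightarrow> 'a::euclidean_space l2 \<Rightarrow> real" where
  "convex_energy F \<rho> = (1/2) * (\<Sum>b\<in>Basis. (norm (weak_partial b \<rho>))\<^sup>2) + (LINT x|lborel. F (rep_l2 \<rho> x))"

text \<open>
  The squared norm of the gradient is split into coordinates, which turns the gradient term into a sum of
  squared norms of the weak partial derivatives in \<open>L\<^sup>2\<close>.
\<close>

lemma energy_decomposition: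
  "energy \<kappa> F \<rho> =
     (if \<rho> \<in> finite_energy F then ereal (\<kappa> / 2 * (norm \<rho>)\<^sup>2 + convex_energy F \<rho>) else \<infinity>)"
proof -
  have sq: "integrable lborel (\<lambda>x. (rep_l2 \<sigma> x)\<^sup>2)" for \<sigma> :: "'a l2"
    using square_integrable_rep by (auto simp: square_integrable_def)
  have n: "(norm \<sigma>)\<^sup>2 = (LINT x|lborel. (rep_l2 \<sigma> x)\<^sup>2)" for \<sigma> :: "'a l2"
    using norm_abs_l2[OF square_integrable_rep, of \<sigma>] by (simp add: abs_rep_l2)
  have "(norm y)\<^sup>2 = (\<Sum>b\<in>Basis. (y \<bullet> b)\<^sup>2)" for y :: 'a
    unfolding power2_norm_eq_inner by (subst euclidean_inner) (simp add: power2_eq_square)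
  then have "(norm (weak_grad \<rho> x))\<^sup>2 = (\<Sum>b\<in>Basis. (rep_l2 (weak_partial b \<rho>) x)\<^sup>2)" for x
    by (simp add: weak_grad_def)
  then have "(LINT x|lborel. (norm (weak_grad \<rho> x))\<^sup>2 + \<kappa> * \<bar>rep_l2 \<rho> x\<bar>\<^sup>2)
      = (\<Sum>b\<in>Basis. (norm (weak_partial b \<rho>))\<^sup>2) + \<kappa> * (norm \<rho>)\<^sup>2"
    by (simp add: n sq)
  then show ?thesis
    by (simp add: energy_def finite_energy_def convex_energy_def algebra_simps add_divide_distrib)
qed

lemma convex_on_convex_energy:
  fixes F :: "real \<Rightarrow> real"
  assumes F0: "\<And>r. 0 \<le> F r" and F: "convex_on UNIV F" and Fc: "continuous_on UNIV F"
  shows "convex_on (finite_energy F :: 'a::euclidean_space l2 set) (convex_energy F)"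
proof -
  have Fm[measurable]: "F \<in> borel_measurable borel" by (rule borel_measurable_continuous_onI[OF Fc])
  have *: "(1 - t) *\<^sub>R \<rho> + t *\<^sub>R \<sigma> \<in> finite_energy F \<and>
      convex_energy F ((1 - t) *\<^sub>R \<rho> + t *\<^sub>R \<sigma>) \<le> (1 - t) * convex_energy F \<rho> + t * convex_energy F \<sigma>"
    if t: "0 \<le> t" "t \<le> 1" and \<rho>: "\<rho> \<in> finite_energy F" and \<sigma>: "\<sigma> \<in> finite_energy F" for t and \<rho> \<sigma> :: "'a l2"
  proof -
    let ?m = "(1 - t) *\<^sub>R \<rho> + t *\<^sub>R \<sigma>"
    have H1: "\<rho> \<in> H1" "\<sigma> \<in> H1" and int: "integrable lborel (\<lambda>x. F (rep_l2 \<rho> x))" "integrable lborel (\<lambda>x. F (rep_l2 \<sigma> x))"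
      using \<rho> \<sigma> by (auto simp: finite_energy_def)
    have le: "AE x in lborel. F (rep_l2 ?m x) \<le> (1 - t) * F (rep_l2 \<rho> x) + t * F (rep_l2 \<sigma> x)"
      using rep_l2_add[of "(1 - t) *\<^sub>R \<rho>" "t *\<^sub>R \<sigma>"] rep_l2_scale[of "1 - t" \<rho>] rep_l2_scale[of t \<sigma>]
    proof eventually_elim
      case (elim x)
      then show ?case using convex_onD[OF F t, of "rep_l2 \<rho> x" "rep_l2 \<sigma> x"] by simp
    qed
    have bound: "integrable lborel (\<lambda>x. (1 - t) * F (rep_l2 \<rho> x) + t * F (rep_l2 \<sigma> x))"
      using int by simp
    have intm: "integrable lborel (\<lambda>x. F (rep_l2 ?m x))"
    proof (rule Bochner_Integration.integrable_bound[OF bound])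
      show "AE x in lborel. norm (F (rep_l2 ?m x)) \<le> norm ((1 - t) * F (rep_l2 \<rho> x) + t * F (rep_l2 \<sigma> x))"
        using le by eventually_elim (use F0 in auto)
    qed simp
    have "(LINT x|lborel. F (rep_l2 ?m x)) \<le> (LINT x|lborel. (1 - t) * F (rep_l2 \<rho> x) + t * F (rep_l2 \<sigma> x))"
      by (rule integral_mono_AE[OF intm bound le])
    also have "\<dots> = (1 - t) * (LINT x|lborel. F (rep_l2 \<rho> x)) + t * (LINT x|lborel. F (rep_l2 \<sigma> x))"
      using int by simp
    finally have Fle: "(LINT x|lborel. F (rep_l2 ?m x)) \<le> \<dots>" .
    have "(\<Sum>b\<in>Basis. (norm (weak_partial b ?m))\<^sup>2)
        \<le> (\<Sum>b\<in>Basis. (1 - t) * (norm (weak_partial b \<rho>))\<^sup>2 + t * (norm (weak_partial b \<sigma>))\<^sup>2)"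
    proof (rule sum_mono)
      fix b :: 'a assume "b \<in> Basis"
      then show "(norm (weak_partial b ?m))\<^sup>2 \<le> (1 - t) * (norm (weak_partial b \<rho>))\<^sup>2 + t * (norm (weak_partial b \<sigma>))\<^sup>2"
        using convex_onD[OF convex_on_norm_square[OF convex_UNIV] t, of "weak_partial b \<rho>" "weak_partial b \<sigma>"]
        by (simp add: weak_partial_lincomb[OF H1])
    qed
    also have "\<dots> = (1 - t) * (\<Sum>b\<in>Basis. (norm (weak_partial b \<rho>))\<^sup>2) + t * (\<Sum>b\<in>Basis. (norm (weak_partial b \<sigma>))\<^sup>2)"
      by (simp add: sum.distrib sum_distrib_left)
    finally have "convex_energy F ?m \<le> (1 - t) * convex_energy F \<rho> + t * convex_energy F \<sigma>"
      using Fle unfolding convex_energy_def distrib_left by linarith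
    moreover have "?m \<in> finite_energy F"
      using intm H1_lincomb[OF H1] by (simp add: finite_energy_def)
    ultimately show ?thesis by blast
  qed
  show ?thesis
  proof (rule convex_onI)
    show "convex (finite_energy F :: 'a l2 set)"
      unfolding convex_alt using * by simp
  qed (use * in auto)
qed

lemma closure_finite_energy:
  assumes Fc: "continuous_on UNIV F" and F0: "F 0 = 0"
  shows "closure (finite_energy F) = (UNIV :: 'a::euclidean_space l2 set)"
proof -
  have Fm[measurable]: "F \<in> borel_measurable borel" by (rule borel_measurable_continuous_onI[OF Fc])
  have "l2_test \<subseteq> (finite_energy F :: 'a l2 set)"
  proof
    fix \<rho> :: "'a l2" assume \<rho>: "\<rho> \<in> l2_test"
    then obtain f where f: "\<rho> = abs_l2 f" "test_function f" by (auto simp: l2_test_def)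
    have fm[measurable]: "f \<in> borel_measurable borel"
      using test_function_continuous[OF f(2)] by (rule borel_measurable_continuous_onI)
    have "integrable lborel (\<lambda>x. F (f x))"
    proof (rule square_integrable_bounded_support(2))
      show "continuous_on UNIV (\<lambda>x. F (f x))"
        by (rule continuous_on_compose2[OF Fc test_function_continuous[OF f(2)]]) simp
      show "bounded {x. F (f x) \<noteq> 0}"
        by (rule bounded_subset[OF test_function_bounded_support[OF f(2)]]) (use F0 in auto)
    qed
    moreover have "AE x in lborel. F (f x) = F (rep_l2 \<rho> x)"
      using rep_abs_l2[OF test_function_square_integrable[OF f(2)]] by eventually_elim (simp add: f(1))
    ultimately have "integrable lborel (\<lambda>x. F (rep_l2 \<rho> x))"
      by (subst integrable_cong_AE[of _ _ "\<lambda>x. F (f x)"]) auto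
    then show "\<rho> \<in> finite_energy F" using \<rho> l2_test_subset_H1 by (auto simp: finite_energy_def)
  qed
  from closure_mono[OF this] show ?thesis by (simp add: closure_l2_test top.extremum_unique)
qed

section \<open>The comparison principle\<close>

lemma tataru_dist_nonneg: "0 \<le> tataru_dist \<kappa> S \<pi> \<rho>"
  unfolding tataru_dist_def by (rule cINF_greatest) auto

text \<open>
  Both conditions on the optimising sequence hold eventually up to \<open>\<eta>\<close>, so a single late member
  satisfies both; this is the form in which the viscosity properties are used.
\<close>

lemma optimising_sequence_element:
  fixes w :: "'e \<Rightarrow> real" and G :: "nat \<Rightarrow> ereal"
  assumes lim: "(\<lambda>n. ereal (w (X n))) \<longlonglongrightarrow> (SUP x. ereal (w x))"
    and bdd: "\<And>x. w x \<le> B" and G: "limsup G \<le> 0" and \<eta>: "0 < \<eta>"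
  obtains n where "\<And>x. w x \<le> w (X n) + \<eta>" "G n < ereal \<eta>"
proof -
  define s where "s = (SUP x. w x)"
  have bd: "bdd_above (range w)" using bdd by (rule bdd_aboveI2)
  have "(SUP x. ereal (w x)) \<le> ereal B" using bdd by (intro SUP_least) simp
  moreover have "ereal (w (X 0)) \<le> (SUP x. ereal (w x))" by (intro SUP_upper) simp
  ultimately have "(SUP x. ereal (w x)) = ereal s"
    unfolding s_def by (intro ereal_SUP[symmetric]) (auto elim!: ereal_cases)
  then have "(\<lambda>n. w (X n)) \<longlonglongrightarrow> s" using lim by simp
  then have "\<forall>\<^sub>F n in sequentially. s - \<eta> < w (X n)" using \<eta> by (intro order_tendstoD(1)) auto
  moreover have "\<forall>\<^sub>F n in sequentially. G n < ereal \<eta>"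
    by (rule Limsup_lessD) (use G \<eta> in \<open>auto intro: le_less_trans\<close>)
  ultimately have "\<forall>\<^sub>F n in sequentially. s - \<eta> < w (X n) \<and> G n < ereal \<eta>" by eventually_elim simp
  then obtain n where n: "s - \<eta> < w (X n)" "G n < ereal \<eta>" by (auto simp: eventually_sequentially)
  have "w x \<le> w (X n) + \<eta>" for x
  proof -
    have "w x \<le> s" unfolding s_def by (rule cSUP_upper[OF _ bd]) simp
    then show ?thesis using n(1) by linarith
  qed
  with n(2) that show ?thesis by blast
qed

text \<open>
  At a point of infinite energy the Hamiltonian is \<open>-\<infinity>\<close>, so the left side of the equation is \<open>\<infinity>\<close> and
  cannot be below \<open>\<eta>\<close>; hence the selected member has finite energy and the inequality becomes a real one.
  Expanding \<open>|\<rho>|\<^sup>2\<close> around \<open>\<pi>\<close> combines the quadratic part of the energy with the term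
  \<open>- a (\<kappa>/2) |\<pi> - \<rho>|\<^sup>2\<close> into \<open>- a \<kappa> (\<pi> \<bullet> (\<pi> - \<rho>))\<close>.
\<close>

lemma subsolution_near_maximiser:
  fixes u h G :: "'e::real_inner \<Rightarrow> real" and m :: 'e and \<kappa> :: real and S :: "real \<Rightarrow> 'e \<Rightarrow> 'e"
  assumes En: "\<And>x. En x = (if x \<in> D then ereal (\<kappa> / 2 * (norm x)\<^sup>2 + G x) else \<infinity>)"
    and l: "0 < l" and sub: "viscosity_subsolution l (H_dagger \<kappa> En S) h u"
    and a: "0 < a" and b: "0 < b" and \<rho>: "\<rho> \<in> D" and \<eta>: "0 < \<eta>"
  defines "T \<equiv> \<lambda>x. tataru_dist \<kappa> S x m"
  shows "\<exists>\<pi>\<in>D.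
      (\<forall>\<pi>'. u \<pi>' - (a / 2 * (norm (\<pi>' - \<rho>))\<^sup>2 + b * T \<pi>') \<le> u \<pi> - (a / 2 * (norm (\<pi> - \<rho>))\<^sup>2 + b * T \<pi>) + \<eta>) \<and>
      u \<pi> \<le> h \<pi> + l * (a * (G \<rho> - G \<pi>) - a * \<kappa> * (\<pi> \<bullet> (\<pi> - \<rho>)) + a\<^sup>2 / 2 * (norm (\<pi> - \<rho>))\<^sup>2
             + (b + a * b * norm (\<pi> - \<rho>) + b\<^sup>2 / 2)) + \<eta>"
proof -
  define f where "f = (\<lambda>\<pi>. (1/2) * a * (dist \<pi> \<rho>)\<^sup>2 + b * tataru_dist \<kappa> S \<pi> m + 0)"
  define q where "q \<pi> = - a * (\<kappa> / 2) * (dist \<pi> \<rho>)\<^sup>2 + b + (1/2) * a\<^sup>2 * (dist \<pi> \<rho>)\<^sup>2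
      + a * b * dist \<pi> \<rho> + (1/2) * b\<^sup>2" for \<pi>
  define g where "g = (\<lambda>\<pi>. ereal a * (En \<rho> - En \<pi>) + ereal (q \<pi>))"
  have "En \<rho> < \<infinity>" using \<rho> by (simp add: En)
  then have "(f, g) \<in> H_dagger \<kappa> En S"
    unfolding H_dagger_def f_def g_def q_def mem_Collect_eq case_prod_conv
    by (intro exI[of _ a] exI[of _ b] exI[of _ 0] exI[of _ m] exI[of _ \<rho>] conjI refl a b)
  then obtain X where X: "(\<lambda>n. ereal (u (X n) - f (X n))) \<longlonglongrightarrow> (SUP x. ereal (u x - f x))"
    "limsup (\<lambda>n. ereal (u (X n)) - ereal l * g (X n) - ereal (h (X n))) \<le> 0"
    using sub unfolding viscosity_subsolution_def by blast
  obtain B where "\<And>x. \<bar>u x\<bar> \<le> B" using sub unfolding viscosity_subsolution_def bounded_iff by auto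
  then have "u x - f x \<le> B" for x
    using tataru_dist_nonneg[of \<kappa> S x m] a b unfolding f_def
    by (smt (verit) mult_nonneg_nonneg zero_le_power2 divide_nonneg_nonneg)
  from optimising_sequence_element[OF X(1) this X(2) \<eta>] obtain n where
    n: "\<And>x. u x - f x \<le> u (X n) - f (X n) + \<eta>"
       "ereal (u (X n)) - ereal l * g (X n) - ereal (h (X n)) < ereal \<eta>" by blast
  let ?\<pi> = "X n"
  have D: "?\<pi> \<in> D"
  proof (rule ccontr)
    assume "?\<pi> \<notin> D"
    then have "g ?\<pi> = - \<infinity>" using a \<rho> by (simp add: g_def En)
    then show False using n(2) l by simp
  qed
  have "u ?\<pi> - l * (a * (\<kappa> / 2 * (norm \<rho>)\<^sup>2 + G \<rho> - (\<kappa> / 2 * (norm ?\<pi>)\<^sup>2 + G ?\<pi>)) + q ?\<pi>) - h ?\<pi> < \<eta>"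
    using n(2) D \<rho> by (simp add: g_def En)
  moreover have "(norm \<rho>)\<^sup>2 = (norm ?\<pi>)\<^sup>2 - 2 * (?\<pi> \<bullet> (?\<pi> - \<rho>)) + (norm (?\<pi> - \<rho>))\<^sup>2"
    unfolding power2_norm_eq_inner by (simp add: inner_diff inner_commute algebra_simps)
  ultimately have "u ?\<pi> \<le> h ?\<pi> + l * (a * (G \<rho> - G ?\<pi>) - a * \<kappa> * (?\<pi> \<bullet> (?\<pi> - \<rho>)) + a\<^sup>2 / 2 * (norm (?\<pi> - \<rho>))\<^sup>2
             + (b + a * b * norm (?\<pi> - \<rho>) + b\<^sup>2 / 2)) + \<eta>"
    by (simp add: q_def dist_norm algebra_simps)
  moreover have "f x = a / 2 * (norm (x - \<rho>))\<^sup>2 + b * T x" for x by (simp add: f_def T_def dist_norm)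
  ultimately show ?thesis using D n(1) by auto
qed

text \<open>
  The mirror image of \<open>subsolution_near_maximiser\<close>; the two limits are negated so that minimising
  sequences become maximising ones.
\<close>

lemma supersolution_near_minimiser:
  fixes v h G :: "'e::real_inner \<Rightarrow> real" and m :: 'e and \<kappa> :: real and S :: "real \<Rightarrow> 'e \<Rightarrow> 'e"
  assumes En: "\<And>x. En x = (if x \<in> D then ereal (\<kappa> / 2 * (norm x)\<^sup>2 + G x) else \<infinity>)"
    and l: "0 < l" and super: "viscosity_supersolution l (H_ddagger \<kappa> En S) h v"
    and a: "0 < a" and b: "0 < b" and \<gamma>: "\<gamma> \<in> D" and \<eta>: "0 < \<eta>"
  defines "T \<equiv> \<lambda>x. tataru_dist \<kappa> S x m"
  shows "\<exists>\<mu>\<in>D.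
      (\<forall>\<mu>'. v \<mu> + (a / 2 * (norm (\<gamma> - \<mu>))\<^sup>2 + b * T \<mu>) - \<eta> \<le> v \<mu>' + (a / 2 * (norm (\<gamma> - \<mu>'))\<^sup>2 + b * T \<mu>')) \<and>
      h \<mu> + l * (a * (G \<mu> - G \<gamma>) - a * \<kappa> * (\<mu> \<bullet> (\<gamma> - \<mu>)) + a\<^sup>2 / 2 * (norm (\<gamma> - \<mu>))\<^sup>2
             - (b + a * b * norm (\<gamma> - \<mu>) + b\<^sup>2 / 2)) - \<eta> \<le> v \<mu>"
proof -
  define f where "f = (\<lambda>\<mu>. - (1/2) * a * (dist \<gamma> \<mu>)\<^sup>2 - b * tataru_dist \<kappa> S \<mu> m + 0)"
  define q where "q \<mu> = a * (\<kappa> / 2) * (dist \<gamma> \<mu>)\<^sup>2 - b + (1/2) * a\<^sup>2 * (dist \<gamma> \<mu>)\<^sup>2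
      - a * b * dist \<gamma> \<mu> - (1/2) * b\<^sup>2" for \<mu>
  define g where "g = (\<lambda>\<mu>. ereal a * (En \<mu> - En \<gamma>) + ereal (q \<mu>))"
  have "En \<gamma> < \<infinity>" using \<gamma> by (simp add: En)
  then have "(f, g) \<in> H_ddagger \<kappa> En S"
    unfolding H_ddagger_def f_def g_def q_def mem_Collect_eq case_prod_conv
    by (intro exI[of _ a] exI[of _ b] exI[of _ 0] exI[of _ m] exI[of _ \<gamma>] conjI refl a b)
  then obtain X where X: "(\<lambda>n. ereal (v (X n) - f (X n))) \<longlonglongrightarrow> (INF x. ereal (v x - f x))"
    "0 \<le> liminf (\<lambda>n. ereal (v (X n)) - ereal l * g (X n) - ereal (h (X n)))"
    using super unfolding viscosity_supersolution_def by blast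
  obtain B where B: "\<And>x. \<bar>v x\<bar> \<le> B" using super unfolding viscosity_supersolution_def bounded_iff by auto
  have "(\<lambda>n. - ereal (v (X n) - f (X n))) \<longlonglongrightarrow> - (INF x. ereal (v x - f x))"
    using X(1) by (rule tendsto_uminus_ereal)
  also have "- (INF x. ereal (v x - f x)) = (SUP x. - ereal (v x - f x))"
    by (simp only: ereal_SUP_uminus_eq)
  finally have X1: "(\<lambda>n. ereal (- (v (X n) - f (X n)))) \<longlonglongrightarrow> (SUP x. ereal (- (v x - f x)))" by simp
  have X2: "limsup (\<lambda>n. - (ereal (v (X n)) - ereal l * g (X n) - ereal (h (X n)))) \<le> 0"
    unfolding ereal_Limsup_uminus using X(2) by simp
  have "- (v x - f x) \<le> B" for x
    using tataru_dist_nonneg[of \<kappa> S x m] a b B[of x] unfolding f_def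
    by (smt (verit) mult_nonneg_nonneg zero_le_power2 divide_nonneg_nonneg minus_mult_left)
  from optimising_sequence_element[OF X1 this X2 \<eta>] obtain n where
    n: "\<And>x. - (v x - f x) \<le> - (v (X n) - f (X n)) + \<eta>"
       "- (ereal (v (X n)) - ereal l * g (X n) - ereal (h (X n))) < ereal \<eta>" by blast
  let ?\<mu> = "X n"
  have D: "?\<mu> \<in> D"
  proof (rule ccontr)
    assume "?\<mu> \<notin> D"
    then have "g ?\<mu> = \<infinity>" using a \<gamma> by (simp add: g_def En)
    then show False using n(2) l by simp
  qed
  have "- (v ?\<mu> - l * (a * (\<kappa> / 2 * (norm ?\<mu>)\<^sup>2 + G ?\<mu> - (\<kappa> / 2 * (norm \<gamma>)\<^sup>2 + G \<gamma>)) + q ?\<mu>) - h ?\<mu>) < \<eta>"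
    using n(2) D \<gamma> by (simp add: g_def En)
  moreover have "(norm \<gamma>)\<^sup>2 = (norm ?\<mu>)\<^sup>2 + 2 * (?\<mu> \<bullet> (\<gamma> - ?\<mu>)) + (norm (\<gamma> - ?\<mu>))\<^sup>2"
    unfolding power2_norm_eq_inner by (simp add: inner_diff inner_commute algebra_simps)
  ultimately have "h ?\<mu> + l * (a * (G ?\<mu> - G \<gamma>) - a * \<kappa> * (?\<mu> \<bullet> (\<gamma> - ?\<mu>)) + a\<^sup>2 / 2 * (norm (\<gamma> - ?\<mu>))\<^sup>2
             - (b + a * b * norm (\<gamma> - ?\<mu>) + b\<^sup>2 / 2)) - \<eta> \<le> v ?\<mu>"
    by (simp add: q_def dist_norm algebra_simps)
  moreover have f: "f x = - (a / 2 * (norm (\<gamma> - x))\<^sup>2 + b * T x)" for x by (simp add: f_def T_def dist_norm)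
  have "v ?\<mu> + (a / 2 * (norm (\<gamma> - ?\<mu>))\<^sup>2 + b * T ?\<mu>) - \<eta> \<le> v \<mu>' + (a / 2 * (norm (\<gamma> - \<mu>'))\<^sup>2 + b * T \<mu>')" for \<mu>'
    using n(1)[of \<mu>'] unfolding f by linarith
  ultimately show ?thesis using D by blast
qed

theorem proposition5p11:
  fixes \<kappa> l :: real and F :: "real \<Rightarrow> real"
    and h1 h2 u v :: "(real ^ 'd) l2 \<Rightarrow> real"
  assumes F_nonneg: "\<And>r. F r \<ge> 0"
    and F_convex: "convex_on UNIV F"
    and F_C1: "F C1_differentiable_on UNIV"
    and F_zero: "F 0 = 0"
    and l_pos: "l > 0"
    and h1_bounded: "bounded (range h1)" and h1_cont: "uniformly_continuous_on UNIV h1"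
    and h2_bounded: "bounded (range h2)" and h2_cont: "uniformly_continuous_on UNIV h2"
    and sub: "viscosity_subsolution l
      (H_dagger \<kappa> (energy \<kappa> F) (evi_flow \<kappa> (energy \<kappa> F))) h1 u"
    and super: "viscosity_supersolution l
      (H_ddagger \<kappa> (energy \<kappa> F) (evi_flow \<kappa> (energy \<kappa> F))) h2 v"
  shows "(SUP \<pi>. u \<pi> - v \<pi>) \<le> (SUP \<pi>. h1 \<pi> - h2 \<pi>)"
proof (rule cSUP_least)
  fix \<pi> :: "(real ^ 'd) l2"
  have F_cont: "continuous_on UNIV F" by (rule C1_differentiable_imp_continuous_on[OF F_C1])
  obtain B1 B2 where B: "\<And>x. \<bar>h1 x\<bar> \<le> B1" "\<And>x. \<bar>h2 x\<bar> \<le> B2"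
    using h1_bounded h2_bounded unfolding bounded_iff by auto
  have "bdd_above (range (\<lambda>\<pi>. h1 \<pi> - h2 \<pi>))"
  proof (rule bdd_aboveI2)
    show "h1 x - h2 x \<le> B1 + B2" for x using B(1)[of x] B(2)[of x] by linarith
  qed
  then have h_le: "h1 x - h2 x \<le> (SUP \<pi>. h1 \<pi> - h2 \<pi>)" for x by (intro cSUP_upper) auto
  have "0 \<le> convex_energy F \<rho>" for \<rho> :: "(real ^ 'd) l2"
    unfolding convex_energy_def by (intro add_nonneg_nonneg mult_nonneg_nonneg sum_nonneg Bochner_Integration.integral_nonneg F_nonneg) auto
  moreover have "bounded (range u)" "bounded (range v)"
    using sub super unfolding viscosity_subsolution_def viscosity_supersolution_def by blast+
  ultimately show "u \<pi> - v \<pi> \<le> (SUP \<pi>. h1 \<pi> - h2 \<pi>)"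
    by (intro comparison_of_near_optimisers[OF closure_finite_energy[OF F_cont F_zero]
          convex_on_convex_energy[OF F_nonneg F_convex F_cont] _ tataru_dist_nonneg[of _ _ _ 0] _ _ l_pos h1_cont h_le
          subsolution_near_maximiser[OF energy_decomposition l_pos sub]
          supersolution_near_minimiser[OF energy_decomposition l_pos super]])
qed simp

end
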